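(* Let $m > 1$ be a real number. If $G$ is $(m,0)$-sparse, then there exists a partition $E(G) = E(F) \cup E(G')$ (with $E(F)\cap E(G')=\emptyset$) such that $F$ is $(1,-1)$-sparse and $G'$ is $(m, 1-2m)$-sparse.
   Context: All graphs are finite and simple. For a graph $H$, $v(H)$ and $e(H)$ denote its numbers of vertices and edges. For $a \in \mathbb{R}_{>0}$ and $b \in \mathbb{R}$, a graph $G$ is $(a,b)$-sparse if every nonempty subgraph $H$ of $G$ satisfies $e(H) \leq a\, v(H) + b$. (In particular, $(1,-1)$-sparse graphs are exactly forests.) *)

theory Defs
  imports Complex_Main
begin

record 'a ugraph =
  verts :: "'a set"
  edges :: "'a set set"

definition simple_graph :: "'a ugraph \<Rightarrow> bool" where
  "simple_graph G \<longleftrightarrow>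
     finite (verts G) \<and> (\<forall>e\<in>edges G. e \<subseteq> verts G \<and> card e = 2)"

definition subgraph :: "'a ugraph \<Rightarrow> 'a ugraph \<Rightarrow> bool" where
  "subgraph H G \<longleftrightarrow>
     simple_graph H \<and> verts H \<subseteq> verts G \<and> edges H \<subseteq> edges G"

text \<open>
  As usual, a graph is nonempty if it has at least one edge. Asking only for a vertex would
  be too strong a notion of sparsity: if \<open>a + b < 0\<close>, as for \<open>(m, 1 - 2 * m)\<close> with \<open>m > 1\<close>,
  a single vertex already violates the inequality, so no graph with a vertex would be sparse.
\<close>

definition sparse :: "real \<Rightarrow> real \<Rightarrow> 'a ugraph \<Rightarrow> bool" where
  "sparse a b G \<longleftrightarrow>
     (\<forall>H. subgraph H G \<and> edges H \<noteq> {} \<longrightarrow>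
        real (card (edges H)) \<le> a * real (card (verts H)) + b)"

end

theory Submission
  imports Defs
begin

text \<open>
  For integral \<open>m\<close> this is a matroid union: the forests and the \<open>(m, 1 - 2 * m)\<close>-sparse edge sets both
  form matroids. For real \<open>m\<close> the second family is not a matroid, and rounding
  \<open>m * (n - 2) + 1\<close> down does not give a submodular bound. Instead the bound is replaced by a smaller
  integral one: with \<open>k = \<lfloor>m\<rfloor>\<close>, only vertex sets of size \<open>n \<ge> n0 = \<lfloor>2 * m\<rfloor>\<close> are constrained (in a simple
  graph smaller sets satisfy the required inequality anyway), and beyond \<open>n0\<close> the bound grows with slope
  \<open>k\<close> only. The loss is affordable because \<open>e(X) \<le> m * |X|\<close> leaves a slack of about \<open>|X| - 2 * m\<close>.

  The rank condition of the matroid union theorem is verified by a count: if the bound \<open>\<beta>\<close> is attained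
  on edge-disjoint blocks \<open>B\<close> and \<open>a(B)\<close> edges of \<open>B\<close> are left over, then \<open>(m - 1) * a(B) < \<beta>(B)\<close>, and
  \<open>\<Sum>B. (a(B) + \<beta>(B)) \<le> m * |W|\<close> forces fewer than \<open>|W|\<close> leftover edges on a connected vertex set \<open>W\<close>.

  Such a bound exists unless \<open>9 / 5 \<le> m < 2\<close>. In that range delete one edge from every minimal set with
  \<open>2 * n - 1\<close> edges, split the rest into two forests, and return each deleted edge to one of the forests.
  The only obstruction is a triangle, and it can be removed by exchanging edges between the two trees.
\<close>

section \<open>Matroid partition\<close>

definition rank_function :: "'e set \<Rightarrow> ('e set \<Rightarrow> nat) \<Rightarrow> bool" where
  "rank_function E r \<longleftrightarrow> r {} = 0 \<and>
     (\<forall>A x. A \<subseteq> E \<longrightarrow> x \<in> E \<longrightarrow> r (insert x A) \<le> r A + 1) \<and>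
     (\<forall>A B. A \<subseteq> B \<longrightarrow> B \<subseteq> E \<longrightarrow> r A \<le> r B) \<and>
     (\<forall>A B. A \<subseteq> E \<longrightarrow> B \<subseteq> E \<longrightarrow> r (A \<union> B) + r (A \<inter> B) \<le> r A + r B)"

lemma rank_mono: "rank_function E r \<Longrightarrow> A \<subseteq> B \<Longrightarrow> B \<subseteq> E \<Longrightarrow> r A \<le> r B"
  by (simp add: rank_function_def)

lemma rank_submodular:
  "rank_function E r \<Longrightarrow> A \<subseteq> E \<Longrightarrow> B \<subseteq> E \<Longrightarrow> r (A \<union> B) + r (A \<inter> B) \<le> r A + r B"
  by (simp add: rank_function_def)

lemma rank_function_restrict:
  assumes "rank_function E r" "E' \<subseteq> E"
  shows "rank_function E' r"
  unfolding rank_function_def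
proof (intro conjI allI impI)
  show "r {} = 0" using assms by (simp add: rank_function_def)
  show "r (insert x A) \<le> r A + 1" if "A \<subseteq> E'" "x \<in> E'" for A x
    using assms that unfolding rank_function_def by (meson order_trans subsetD)
  show "r A \<le> r B" if "A \<subseteq> B" "B \<subseteq> E'" for A B
    using rank_mono[OF assms(1)] that assms(2) by auto
  show "r (A \<union> B) + r (A \<inter> B) \<le> r A + r B" if "A \<subseteq> E'" "B \<subseteq> E'" for A B
    using rank_submodular[OF assms(1)] that assms(2) by auto
qed

lemma rank_le_card:
  assumes r: "rank_function E r" and "finite A" "A \<subseteq> E"
  shows "r A \<le> card A"
  using assms(2,3)
proof (induction A rule: finite_induct)
  case empty
  then show ?case using r by (simp add: rank_function_def)
next
  case (insert x A)
  then have "r (insert x A) \<le> r A + 1" using r by (auto simp: rank_function_def)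
  then show ?case using insert by auto
qed

lemma rank_function_contract:
  assumes r: "rank_function E r" and A: "A \<subseteq> E"
  shows "rank_function (E - A) (\<lambda>X. r (X \<union> A) - r A)"
proof -
  note mono = rank_mono[OF r] and sub = rank_submodular[OF r]
  have 1: "r (insert x X \<union> A) - r A \<le> r (X \<union> A) - r A + 1" if "X \<subseteq> E - A" "x \<in> E - A" for X x
  proof -
    have "X \<union> A \<subseteq> E" "x \<in> E" using that A by auto
    then have "r (insert x (X \<union> A)) \<le> r (X \<union> A) + 1"
      using r by (simp add: rank_function_def)
    then show ?thesis by simp
  qed
  have 2: "r (X \<union> A) - r A \<le> r (Y \<union> A) - r A" if "X \<subseteq> Y" "Y \<subseteq> E - A" for X Y
    using mono[of "X \<union> A" "Y \<union> A"] that A by (auto intro!: diff_le_mono)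
  have 3: "(r (X \<union> Y \<union> A) - r A) + (r (X \<inter> Y \<union> A) - r A) \<le> (r (X \<union> A) - r A) + (r (Y \<union> A) - r A)"
    if "X \<subseteq> E - A" "Y \<subseteq> E - A" for X Y
  proof -
    have XY: "X \<union> A \<subseteq> E" "Y \<union> A \<subseteq> E" "X \<union> Y \<union> A \<subseteq> E" "X \<inter> Y \<union> A \<subseteq> E"
      using that A by auto
    have "(X \<union> A) \<union> (Y \<union> A) = X \<union> Y \<union> A" "(X \<union> A) \<inter> (Y \<union> A) = X \<inter> Y \<union> A" by auto
    then have "r (X \<union> Y \<union> A) + r (X \<inter> Y \<union> A) \<le> r (X \<union> A) + r (Y \<union> A)"
      using sub[OF XY(1,2)] by simp
    \<comment> \<open>These make all four truncated differences exact, so submodularity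
      transfers.\<close>
    moreover have "r A \<le> r (X \<union> Y \<union> A)" "r A \<le> r (X \<inter> Y \<union> A)" "r A \<le> r (X \<union> A)" "r A \<le> r (Y \<union> A)"
      using XY by (auto intro!: mono)
    ultimately show ?thesis by linarith
  qed
  show ?thesis unfolding rank_function_def by (intro conjI allI impI) (simp, fact 1, fact 2, fact 3)
qed

section \<open>Partition of a ground set into two independent sets\<close>

definition partitionable :: "'e set \<Rightarrow> ('e set \<Rightarrow> nat) \<Rightarrow> ('e set \<Rightarrow> nat) \<Rightarrow> bool" where
  "partitionable E r1 r2 \<longleftrightarrow> (\<exists>I1 I2. I1 \<union> I2 = E \<and> I1 \<inter> I2 = {} \<and> r1 I1 = card I1 \<and> r2 I2 = card I2)"

lemma partitionable_commute: "partitionable E r1 r2 \<longleftrightarrow> partitionable E r2 r1"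
  unfolding partitionable_def by (subst ex_comm) (simp add: Un_commute Int_commute conj_ac)

text \<open>Submodularity for \<open>A\<close> and \<open>I \<union> J\<close>, whose intersection
  contains the spanning set \<open>I\<close>. It glues bases of a tight set to independent sets of
  the contraction.\<close>

lemma rank_span_union:
  assumes r: "rank_function E r" and "A \<subseteq> E" "J \<subseteq> E" "I \<subseteq> A" and "r I = r A"
  shows "r (I \<union> J) = r (A \<union> J)"
proof -
  have "r (A \<union> (I \<union> J)) + r (A \<inter> (I \<union> J)) \<le> r A + r (I \<union> J)"
    using assms by (intro rank_submodular[OF r]) auto
  moreover have "A \<union> (I \<union> J) = A \<union> J" using assms by auto
  moreover have "r I \<le> r (A \<inter> (I \<union> J))"
    using assms by (intro rank_mono[OF r]) auto
  moreover have "r (I \<union> J) \<le> r (A \<union> J)"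
    using assms by (intro rank_mono[OF r]) auto
  ultimately show ?thesis using assms(5) by simp
qed

lemma partitionable_insert:
  assumes r1: "rank_function E r1" and e: "e \<in> E" "r1 {e} = 1" and fin: "finite E"
    and "partitionable (E - {e}) (\<lambda>X. r1 (X \<union> {e}) - r1 {e}) r2"
  shows "partitionable E r1 r2"
proof -
  obtain I1 I2 where I: "I1 \<union> I2 = E - {e}" "I1 \<inter> I2 = {}"
    "r1 (I1 \<union> {e}) - r1 {e} = card I1" "r2 I2 = card I2"
    using assms(5) unfolding partitionable_def by auto
  have "r1 {e} \<le> r1 (I1 \<union> {e})"
    using I e by (intro rank_mono[OF r1]) auto
  moreover have "finite I1" using I fin by (metis finite_Diff finite_Un)
  moreover have "e \<notin> I1" using I by auto
  ultimately have "r1 (insert e I1) = card (insert e I1)" using I e by simp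
  then show ?thesis unfolding partitionable_def
    using I e by (intro exI[of _ "insert e I1"] exI[of _ I2]) auto
qed

text \<open>Induction on the size of the ground set. A proper nonempty set with equality is
  partitioned first and both matroids are contracted by it; the equality preserves the rank
  condition. If there is none, every proper nonempty set has slack at least one, which pays for
  contracting a single element in one matroid only.\<close>

theorem matroid_partition:
  assumes "finite E" "rank_function E r1" "rank_function E r2"
    and "\<And>A. A \<subseteq> E \<Longrightarrow> card A \<le> r1 A + r2 A"
  shows "partitionable E r1 r2"
  using assms
proof (induction "card E" arbitrary: E r1 r2 rule: less_induct)
  case less
  note fin = less.prems(1) and r1 = less.prems(2) and r2 = less.prems(3) and hall = less.prems(4)
  consider (empty) "E = {}" | (tight) A where "A \<subseteq> E" "A \<noteq> {}" "A \<noteq> E" "card A = r1 A + r2 A"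
    | (loose) e where "e \<in> E" "\<And>A. A \<subseteq> E \<Longrightarrow> A \<noteq> {} \<Longrightarrow> A \<noteq> E \<Longrightarrow> card A < r1 A + r2 A"
  proof -
    assume *: "E = {} \<Longrightarrow> thesis"
      "\<And>A. A \<subseteq> E \<Longrightarrow> A \<noteq> {} \<Longrightarrow> A \<noteq> E \<Longrightarrow> card A = r1 A + r2 A \<Longrightarrow> thesis"
      "\<And>e. e \<in> E \<Longrightarrow> (\<And>A. A \<subseteq> E \<Longrightarrow> A \<noteq> {} \<Longrightarrow> A \<noteq> E \<Longrightarrow> card A < r1 A + r2 A) \<Longrightarrow> thesis"
    show thesis
    proof (rule ccontr)
      assume n: "\<not> thesis"
      then obtain e where "e \<in> E" using *(1) by auto
      moreover have "card A < r1 A + r2 A" if "A \<subseteq> E" "A \<noteq> {}" "A \<noteq> E" for A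
        using hall[OF that(1)] *(2)[OF that] n by linarith
      ultimately show False using *(3) n by blast
    qed
  qed
  then show ?case
  proof cases
    case empty
    then show ?thesis using r1 r2 by (auto simp: partitionable_def rank_function_def)
  next
    case tight
    have "card A < card E" using tight(1-3) fin by (intro psubset_card_mono) auto
    then have "partitionable A r1 r2"
    proof (rule less.hyps)
      show "card B \<le> r1 B + r2 B" if "B \<subseteq> A" for B
        using hall that tight by auto
    qed (use tight fin rank_function_restrict[OF r1] rank_function_restrict[OF r2] in
        \<open>auto intro: finite_subset\<close>)
    then obtain I1 I2 where I: "I1 \<union> I2 = A" "I1 \<inter> I2 = {}" "r1 I1 = card I1" "r2 I2 = card I2"
      unfolding partitionable_def by auto
    have finA: "finite A" using tight fin finite_subset by auto
    have lt: "card (E - A) < card E"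
      using tight fin by (intro psubset_card_mono) auto
    have mono1: "r1 X \<le> r1 Y" and mono2: "r2 X \<le> r2 Y" if "X \<subseteq> Y" "Y \<subseteq> E" for X Y
      using that rank_mono[OF r1] rank_mono[OF r2] by auto
    have "card X \<le> (r1 (X \<union> A) - r1 A) + (r2 (X \<union> A) - r2 A)" if "X \<subseteq> E - A" for X
    proof -
      have "X \<union> A \<subseteq> E" using that tight by auto
      then have "card (X \<union> A) \<le> r1 (X \<union> A) + r2 (X \<union> A)" by (rule hall)
      moreover have "card (X \<union> A) = card X + card A"
        using that fin finA by (subst card_Un_disjoint) (auto intro: finite_subset)
      moreover have "r1 A \<le> r1 (X \<union> A)" "r2 A \<le> r2 (X \<union> A)"
        using mono1 mono2 \<open>X \<union> A \<subseteq> E\<close> by auto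
      ultimately show ?thesis using tight by linarith
    qed
    then have "partitionable (E - A) (\<lambda>X. r1 (X \<union> A) - r1 A) (\<lambda>X. r2 (X \<union> A) - r2 A)"
      using less.hyps[OF lt, of "\<lambda>X. r1 (X \<union> A) - r1 A" "\<lambda>X. r2 (X \<union> A) - r2 A"]
        fin tight rank_function_contract[OF r1] rank_function_contract[OF r2] by auto
    then obtain J1 J2 where J: "J1 \<union> J2 = E - A" "J1 \<inter> J2 = {}"
      "r1 (J1 \<union> A) - r1 A = card J1" "r2 (J2 \<union> A) - r2 A = card J2"
      unfolding partitionable_def by auto
    have cardA: "card A = card I1 + card I2"
      using I finA by (metis card_Un_disjoint finite_Un)
    have le: "r1 I1 \<le> r1 A" "r2 I2 \<le> r2 A"
      using I(1) tight(1) by (auto intro!: mono1 mono2)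
    \<comment> \<open>\<open>card A = r1 A + r2 A\<close> leaves no slack, so \<open>I1\<close> and
      \<open>I2\<close> span \<open>A\<close> in their matroids.\<close>
    have eq: "r1 I1 = r1 A" "r2 I2 = r2 A" using le cardA I tight by linarith+
    have sub: "J1 \<subseteq> E" "J2 \<subseteq> E" "I1 \<subseteq> A" "I2 \<subseteq> A" using I J by auto
    have fins: "finite I1" "finite I2" "finite J1" "finite J2"
      using sub fin finA by (auto intro: finite_subset)
    have "r1 (I1 \<union> J1) = r1 (A \<union> J1)" "r2 (I2 \<union> J2) = r2 (A \<union> J2)"
      using rank_span_union[OF r1 _ sub(1,3) eq(1)] rank_span_union[OF r2 _ sub(2,4) eq(2)]
        tight by auto
    moreover have "r1 A \<le> r1 (J1 \<union> A)" "r2 A \<le> r2 (J2 \<union> A)"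
      using mono1 mono2 sub tight by auto
    moreover have "card (I1 \<union> J1) = card I1 + card J1" "card (I2 \<union> J2) = card I2 + card J2"
      using fins I J by (subst card_Un_disjoint; auto)+
    ultimately have "r1 (I1 \<union> J1) = card (I1 \<union> J1)" "r2 (I2 \<union> J2) = card (I2 \<union> J2)"
      using J eq I by (simp_all add: Un_commute)
    moreover have "(I1 \<union> J1) \<union> (I2 \<union> J2) = E" "(I1 \<union> J1) \<inter> (I2 \<union> J2) = {}"
      using I J tight by auto
    ultimately show ?thesis unfolding partitionable_def by blast
  next
    case loose
    have lt: "card (E - {e}) < card E" using loose(1) fin by (intro psubset_card_mono) auto
    \<comment> \<open>Contracting \<open>e\<close> lowers the first rank by at most one, which
      strictness absorbs. The step is stated for arbitrary \<open>s1\<close> and \<open>s2\<close>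
      since \<open>e\<close> may be a loop in one matroid, and then the roles are exchanged.\<close>
    have step: "partitionable E s1 s2"
      if s: "rank_function E s1" "rank_function E s2" "s1 {e} = 1"
        and lo: "\<And>A. A \<subseteq> E \<Longrightarrow> A \<noteq> {} \<Longrightarrow> A \<noteq> E \<Longrightarrow> card A < s1 A + s2 A" for s1 s2
    proof (rule partitionable_insert[OF s(1) loose(1) s(3) fin])
      show "partitionable (E - {e}) (\<lambda>X. s1 (X \<union> {e}) - s1 {e}) s2"
      proof (rule less.hyps[OF lt])
        fix X assume X: "X \<subseteq> E - {e}"
        show "card X \<le> (s1 (X \<union> {e}) - s1 {e}) + s2 X"
        proof (cases "X = {}")
          case False
          then have "card X < s1 X + s2 X" using X loose(1) by (intro lo) auto
          moreover have "s1 X \<le> s1 (X \<union> {e})"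
            using X loose(1) by (intro rank_mono[OF s(1)]) auto
          ultimately show ?thesis using s(3) by linarith
        qed simp
      qed (use fin rank_function_contract[OF s(1), of "{e}"] rank_function_restrict[OF s(2)] loose(1) in auto)
    qed
    have "card {e} \<le> r1 {e} + r2 {e}" using hall loose(1) by blast
    moreover have "r1 {e} \<le> 1" "r2 {e} \<le> 1"
      using rank_le_card[OF r1, of "{e}"] rank_le_card[OF r2, of "{e}"] loose(1) by auto
    ultimately have "r1 {e} = 1 \<or> r2 {e} = 1" by simp linarith
    then consider "r1 {e} = 1" | "r2 {e} = 1" by blast
    then show ?thesis
    proof cases
      case 1
      then show ?thesis by (rule step[OF r1 r2 _ loose(2)])
    next
      case 2
      then have "partitionable E r2 r1" using loose(2) by (intro step[OF r2 r1]) (auto simp: add.commute)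
      then show ?thesis by (simp add: partitionable_commute)
    qed
  qed
qed

section \<open>Matroids given by independent sets\<close>

locale matroid =
  fixes E :: "'e set" and indep :: "'e set \<Rightarrow> bool"
  assumes finite_ground: "finite E"
    and indep_empty: "indep {}"
    and indep_subset: "indep I \<Longrightarrow> J \<subseteq> I \<Longrightarrow> indep J"
    and card_le_maximal: "A \<subseteq> E \<Longrightarrow> I \<subseteq> A \<Longrightarrow> indep I \<Longrightarrow> (\<And>x. x \<in> A - I \<Longrightarrow> \<not> indep (insert x I)) \<Longrightarrow>
      J \<subseteq> A \<Longrightarrow> indep J \<Longrightarrow> card J \<le> card I"
begin

definition basis :: "'e set \<Rightarrow> 'e set \<Rightarrow> bool" where
  "basis A I \<longleftrightarrow> I \<subseteq> A \<and> indep I \<and> (\<forall>x\<in>A - I. \<not> indep (insert x I))"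

definition rank :: "'e set \<Rightarrow> nat" where
  "rank A = Max (card ` {I. I \<subseteq> A \<and> indep I})"

lemma card_le_rank:
  assumes "A \<subseteq> E" "I \<subseteq> A" "indep I"
  shows "card I \<le> rank A"
proof -
  have "finite {I. I \<subseteq> A \<and> indep I}"
    using finite_subset[OF assms(1) finite_ground] by simp
  then show ?thesis unfolding rank_def using assms by (intro Max_ge) auto
qed

lemma rank_basis:
  assumes "A \<subseteq> E" "basis A I"
  shows "rank A = card I"
proof -
  have "finite {I. I \<subseteq> A \<and> indep I}"
    using finite_subset[OF assms(1) finite_ground] by simp
  then show ?thesis unfolding rank_def
    using assms card_le_maximal[OF assms(1)] unfolding basis_def by (intro Max_eqI) auto
qed

lemma extend_basis:
  assumes "A \<subseteq> E" "I \<subseteq> A" "indep I"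
  obtains K where "I \<subseteq> K" "basis A K"
proof -
  let ?S = "{K. I \<subseteq> K \<and> K \<subseteq> A \<and> indep K}"
  have "finite ?S"
    using finite_subset[OF assms(1) finite_ground] by simp
  moreover have "I \<in> ?S" using assms by auto
  ultimately obtain K where K: "K \<in> ?S" "\<And>K'. K' \<in> ?S \<Longrightarrow> K \<subseteq> K' \<Longrightarrow> K = K'"
    using finite_has_maximal[of ?S] by (metis (no_types, lifting) empty_iff)
  have "basis A K" unfolding basis_def
  proof (intro conjI ballI notI)
    fix x assume x: "x \<in> A - K" "indep (insert x K)"
    then have "insert x K \<in> ?S" using K(1) by auto
    then show False using K(2)[of "insert x K"] x by auto
  qed (use K in auto)
  then show ?thesis using that K(1) by auto
qed

lemma basis_exists:
  assumes "A \<subseteq> E" obtains K where "basis A K"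
  by (rule extend_basis[OF assms, of "{}"]) (auto simp: indep_empty)

lemma rank_function_rank: "rank_function E rank"
proof -
  have mono: "rank A \<le> rank B" if AB: "A \<subseteq> B" "B \<subseteq> E" for A B
  proof -
    have A: "A \<subseteq> E" using AB by auto
    obtain K where K: "basis A K" using basis_exists[OF A] .
    then have "rank A = card K" by (rule rank_basis[OF A])
    also have "\<dots> \<le> rank B" using K AB unfolding basis_def by (intro card_le_rank) auto
    finally show ?thesis .
  qed
  have 1: "rank (insert x A) \<le> rank A + 1" if "A \<subseteq> E" "x \<in> E" for A x
  proof -
    have A: "insert x A \<subseteq> E" using that by auto
    obtain K where K: "basis (insert x A) K" using basis_exists[OF A] .
    have "card K \<le> card (K - {x}) + 1"
      by (cases "x \<in> K") (simp_all add: card_Diff_singleton)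
    moreover have "card (K - {x}) \<le> rank A"
      using K that unfolding basis_def by (intro card_le_rank) (auto intro: indep_subset[of K])
    ultimately show ?thesis using rank_basis[OF A K] by simp
  qed
  \<comment> \<open>A basis \<open>I\<close> of the intersection extends to a basis of the union.
    The latter meets \<open>A\<close> and \<open>B\<close> in independent sets and meets
    \<open>A \<inter> B\<close> in exactly \<open>I\<close>, by maximality of
    \<open>I\<close>.\<close>
  have 2: "rank (A \<union> B) + rank (A \<inter> B) \<le> rank A + rank B" if "A \<subseteq> E" "B \<subseteq> E" for A B
  proof -
    have AB: "A \<union> B \<subseteq> E" "A \<inter> B \<subseteq> E" using that by auto
    obtain I where I: "basis (A \<inter> B) I" using basis_exists[OF AB(2)] .
    then have I': "I \<subseteq> A \<union> B" "indep I" by (auto simp: basis_def)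
    obtain K where K: "I \<subseteq> K" "basis (A \<union> B) K" using extend_basis[OF AB(1) I'] .
    have "K \<subseteq> E" using K(2) AB by (auto simp: basis_def)
    then have fin: "finite K" using finite_ground by (rule finite_subset)
    have "K \<inter> A \<inter> B = I"
    proof
      show "K \<inter> A \<inter> B \<subseteq> I"
      proof
        fix x assume x: "x \<in> K \<inter> A \<inter> B"
        then have "indep (insert x I)" using K unfolding basis_def by (auto intro: indep_subset[of K])
        then show "x \<in> I" using I x unfolding basis_def by auto
      qed
    qed (use I K in \<open>auto simp: basis_def\<close>)
    moreover have "K \<inter> A \<union> K \<inter> B = K" "K \<inter> A \<inter> (K \<inter> B) = K \<inter> A \<inter> B"
      using K(2) unfolding basis_def by auto
    ultimately have "card K + card I = card (K \<inter> A) + card (K \<inter> B)"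
      using card_Un_Int[of "K \<inter> A" "K \<inter> B"] fin by simp
    moreover have "card (K \<inter> A) \<le> rank A" "card (K \<inter> B) \<le> rank B"
      using K(2) that unfolding basis_def by (auto intro!: card_le_rank intro: indep_subset[of K])
    moreover have "rank (A \<union> B) = card K" "rank (A \<inter> B) = card I"
      using rank_basis[OF AB(1) K(2)] rank_basis[OF AB(2) I] .
    ultimately show ?thesis by linarith
  qed
  have 0: "rank {} = 0" using rank_basis[of "{}" "{}"] indep_empty by (auto simp: basis_def)
  show ?thesis unfolding rank_function_def
    by (intro conjI allI impI) (fact 0, fact 1, fact mono, fact 2)
qed

lemma indep_iff_rank:
  assumes "I \<subseteq> E" "rank I = card I"
  shows "indep I"
proof -
  obtain K where K: "basis I K" using basis_exists[OF assms(1)] .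
  then have "card K = card I" using rank_basis[OF assms(1)] assms(2) by simp
  moreover have "finite I" using assms(1) finite_ground by (rule finite_subset)
  moreover have "K \<subseteq> I" using K by (simp add: basis_def)
  ultimately have "K = I" by (simp add: card_subset_eq)
  then show ?thesis using K unfolding basis_def by auto
qed

end

section \<open>Count matroids\<close>

definition induced :: "'a set set \<Rightarrow> 'a set \<Rightarrow> 'a set set" where
  "induced I X = {e \<in> I. e \<subseteq> X}"

lemma induced_mono: "I \<subseteq> J \<Longrightarrow> X \<subseteq> Y \<Longrightarrow> induced I X \<subseteq> induced J Y"
  by (auto simp: induced_def)

lemma induced_insert:
  "induced (insert e I) X = (if e \<subseteq> X then insert e (induced I X) else induced I X)"
  by (auto simp: induced_def)

lemma card_induced_supermodular:
  assumes "finite I"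
  shows "card (induced I X) + card (induced I Y) \<le> card (induced I (X \<union> Y)) + card (induced I (X \<inter> Y))"
proof -
  have fin: "finite (induced I Z)" for Z using assms by (simp add: induced_def)
  have "card (induced I X) + card (induced I Y)
      = card (induced I X \<union> induced I Y) + card (induced I X \<inter> induced I Y)"
    by (rule card_Un_Int[OF fin fin])
  also have "card (induced I X \<union> induced I Y) \<le> card (induced I (X \<union> Y))"
    by (rule card_mono[OF fin]) (auto simp: induced_def)
  also have "induced I X \<inter> induced I Y = induced I (X \<inter> Y)" by (auto simp: induced_def)
  finally show ?thesis by simp
qed

text \<open>
  Below the threshold the bound is the trivial one for simple graphs, so only sets of size at least
  \<open>n0\<close> are constrained. Taking the trivial bound for \<open>\<beta> j\<close> there lets \<open>uncross\<close> cover small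
  intersections as well.
\<close>

locale count_function =
  fixes \<beta> :: "nat \<Rightarrow> nat" and n0 :: nat
  assumes below_threshold: "n < n0 \<Longrightarrow> \<beta> n = n choose 2"
    and uncross: "n0 \<le> x \<Longrightarrow> n0 \<le> y \<Longrightarrow> 2 \<le> j \<Longrightarrow> j \<le> x \<Longrightarrow> j \<le> y \<Longrightarrow>
      \<beta> (x + y - j) + \<beta> j \<le> \<beta> x + \<beta> y"
    and superadditive: "\<beta> x + \<beta> y \<le> \<beta> (x + y)"
begin

lemma \<beta>_mono: "x \<le> y \<Longrightarrow> \<beta> x \<le> \<beta> y"
  using superadditive[of x "y - x"] by simp

lemma \<beta>_sum: "finite S \<Longrightarrow> (\<Sum>i\<in>S. \<beta> (f i)) \<le> \<beta> (\<Sum>i\<in>S. f i)"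
proof (induction S rule: finite_induct)
  case (insert i S)
  then show ?case using superadditive[of "f i" "sum f S"] by simp
qed simp

end

locale edge_set =
  fixes V :: "'a set" and E :: "'a set set"
  assumes finite_V: "finite V"
    and edge: "e \<in> E \<Longrightarrow> e \<subseteq> V \<and> card e = 2"
begin

lemma finite_E: "finite E"
proof (rule finite_subset)
  show "E \<subseteq> Pow V" using edge by auto
qed (use finite_V in simp)

lemma finite_sub: "I \<subseteq> E \<Longrightarrow> finite I"
  using finite_E finite_subset by auto

lemma finite_induced: "I \<subseteq> E \<Longrightarrow> finite (induced I X)"
  using finite_sub by (simp add: induced_def)

lemma card_induced_le_choose:
  assumes "I \<subseteq> E" "X \<subseteq> V"
  shows "card (induced I X) \<le> card X choose 2"
proof -
  have X: "finite X" using assms finite_V finite_subset by auto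
  have "induced I X \<subseteq> {e. e \<subseteq> X \<and> card e = 2}" using assms edge by (auto simp: induced_def)
  then have "card (induced I X) \<le> card {e. e \<subseteq> X \<and> card e = 2}"
    using X by (intro card_mono) auto
  then show ?thesis using n_subsets[OF X] by simp
qed

lemma card_Int_ge_2:
  assumes "e \<in> E" "e \<subseteq> X" "e \<subseteq> Y" "X \<subseteq> V"
  shows "2 \<le> card (X \<inter> Y)"
proof -
  have "finite (X \<inter> Y)" using assms finite_V by (meson finite_Int finite_subset)
  then show ?thesis using assms edge[OF assms(1)] card_mono[of "X \<inter> Y" e] by auto
qed

end

section \<open>Count matroids, tight sets and blocks\<close>

locale count_matroid = edge_set V E + count_function \<beta> n0
  for V :: "'a set" and E :: "'a set set" and \<beta> :: "nat \<Rightarrow> nat" and n0 :: nat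
begin

definition indep :: "'a set set \<Rightarrow> bool" where
  "indep I \<longleftrightarrow> I \<subseteq> E \<and> (\<forall>X\<subseteq>V. card (induced I X) \<le> \<beta> (card X))"

definition tight :: "'a set set \<Rightarrow> 'a set \<Rightarrow> bool" where
  "tight I X \<longleftrightarrow> X \<subseteq> V \<and> n0 \<le> card X \<and> card (induced I X) = \<beta> (card X)"

definition blocks :: "'a set set \<Rightarrow> 'a set set" where
  "blocks I = {X. tight I X \<and> (\<forall>Y. tight I Y \<longrightarrow> X \<subseteq> Y \<longrightarrow> Y = X)}"

text \<open>Supermodular edge counts meet the submodular bound of \<open>uncross\<close>, while
  independence caps the union and the intersection, so equality holds at the union. The intersection
  may be smaller than \<open>n0\<close>.\<close>

lemma tight_Un:
  assumes I: "indep I" and X: "tight I X" and Y: "tight I Y" and j: "2 \<le> card (X \<inter> Y)"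
  shows "tight I (X \<union> Y)"
proof -
  have V: "X \<subseteq> V" "Y \<subseteq> V" using X Y by (auto simp: tight_def)
  then have fin: "finite X" "finite Y" using finite_V finite_subset by auto
  have u: "card (X \<union> Y) = card X + card Y - card (X \<inter> Y)"
    using card_Un_Int[OF fin] by simp
  have le: "card (X \<inter> Y) \<le> card X" "card (X \<inter> Y) \<le> card Y" using fin by (auto intro: card_mono)
  have "\<beta> (card (X \<union> Y)) + \<beta> (card (X \<inter> Y)) \<le> \<beta> (card X) + \<beta> (card Y)"
    unfolding u using X Y j le by (intro uncross) (auto simp: tight_def)
  also have "\<dots> = card (induced I X) + card (induced I Y)" using X Y by (simp add: tight_def)
  also have "\<dots> \<le> card (induced I (X \<union> Y)) + card (induced I (X \<inter> Y))"
    using I by (intro card_induced_supermodular) (auto simp: indep_def finite_sub)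
  also have "card (induced I (X \<inter> Y)) \<le> \<beta> (card (X \<inter> Y))"
    using I V unfolding indep_def by (simp add: le_infI1)
  finally have "\<beta> (card (X \<union> Y)) \<le> card (induced I (X \<union> Y))" by simp
  moreover have "card (induced I (X \<union> Y)) \<le> \<beta> (card (X \<union> Y))"
    using I V unfolding indep_def by auto
  moreover have "n0 \<le> card (X \<union> Y)"
    using X fin card_mono[of "X \<union> Y" X] by (auto simp: tight_def)
  ultimately show ?thesis using V by (auto simp: tight_def)
qed

lemma finite_blocks: "finite (blocks I)"
proof (rule finite_subset)
  show "blocks I \<subseteq> Pow V" by (auto simp: blocks_def tight_def)
qed (use finite_V in simp)

lemma tight_in_block:
  assumes "tight I X" obtains B where "B \<in> blocks I" "X \<subseteq> B"
proof -
  let ?S = "{Y. tight I Y \<and> X \<subseteq> Y}"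
  have "?S \<subseteq> Pow V" by (auto simp: tight_def)
  then have "finite ?S" using finite_V by (meson finite_Pow_iff finite_subset)
  moreover have "X \<in> ?S" using assms by simp
  ultimately obtain B where B: "B \<in> ?S" "\<And>Y. Y \<in> ?S \<Longrightarrow> B \<subseteq> Y \<Longrightarrow> B = Y"
    using finite_has_maximal[of ?S] by (metis (no_types, lifting) empty_iff)
  then have "B \<in> blocks I" unfolding blocks_def by auto
  then show ?thesis using that B(1) by auto
qed

lemma edge_in_one_block:
  assumes I: "indep I" and B: "B \<in> blocks I" "B' \<in> blocks I" and e: "e \<in> E" "e \<subseteq> B" "e \<subseteq> B'"
  shows "B = B'"
proof -
  have "2 \<le> card (B \<inter> B')"
    using e B by (intro card_Int_ge_2) (auto simp: blocks_def tight_def)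
  then have "tight I (B \<union> B')" using tight_Un[OF I] B by (auto simp: blocks_def)
  then have "B \<union> B' = B" "B \<union> B' = B'" using B unfolding blocks_def by blast+
  then show ?thesis by simp
qed

text \<open>A violated set contains \<open>e\<close> and was at its bound before \<open>e\<close>
  was added. It has at least \<open>n0\<close> vertices, since smaller sets of a simple graph
  satisfy the binomial bound automatically; hence it is tight and lies in a block.\<close>

lemma dependent_in_block:
  assumes I: "indep I" and e: "e \<in> E" "\<not> indep (insert e I)"
  shows "\<exists>B\<in>blocks I. e \<subseteq> B"
proof -
  have "insert e I \<subseteq> E" using I e by (auto simp: indep_def)
  then obtain X where X: "X \<subseteq> V" "card (induced (insert e I) X) > \<beta> (card X)"
    using e unfolding indep_def by force
  have le: "card (induced I X) \<le> \<beta> (card X)" using I X by (auto simp: indep_def)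
  then have eX: "e \<subseteq> X" using X by (auto simp: induced_insert split: if_splits)
  then have "card (induced (insert e I) X) \<le> card (induced I X) + 1"
    using I by (simp add: induced_insert card_insert_if finite_induced indep_def)
  then have "card (induced I X) = \<beta> (card X)" using le X by simp
  moreover have "n0 \<le> card X"
  proof (rule ccontr)
    assume "\<not> n0 \<le> card X"
    then show False
      using X(2) below_threshold[of "card X"] card_induced_le_choose[OF \<open>insert e I \<subseteq> E\<close> X(1)] by simp
  qed
  ultimately have "tight I X" using X by (simp add: tight_def)
  then obtain B where "B \<in> blocks I" "X \<subseteq> B" by (rule tight_in_block)
  then show ?thesis using eX by auto
qed

text \<open>By maximality the edges of \<open>J\<close> outside all blocks lie in \<open>I\<close>;
  every other edge belongs to a single block, where \<open>I\<close> attains the bound. For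
  independent \<open>J\<close> this gives the axiom \<open>card_le_maximal\<close>; for
  \<open>J = A\<close> it bounds the number of edges left over by \<open>I\<close> by what is left
  over in its blocks.\<close>

lemma card_le_blocks:
  assumes A: "A \<subseteq> E" and I: "I \<subseteq> A" "indep I" and max: "\<And>x. x \<in> A - I \<Longrightarrow> \<not> indep (insert x I)"
    and J: "J \<subseteq> A"
  shows "card J + (\<Sum>B\<in>blocks I. \<beta> (card B)) \<le> card I + (\<Sum>B\<in>blocks I. card (induced J B))"
proof -
  let ?U = "\<Union>B\<in>blocks I. {e. e \<subseteq> B}"
  have split: "card K = card (K - ?U) + (\<Sum>B\<in>blocks I. card (induced K B))" if K: "K \<subseteq> A" for K
  proof -
    have KE: "K \<subseteq> E" using K A by auto
    have fin: "finite K" by (rule finite_sub[OF KE])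
    have "K \<inter> ?U = (\<Union>B\<in>blocks I. induced K B)" by (auto simp: induced_def)
    also have "card \<dots> = (\<Sum>B\<in>blocks I. card (induced K B))"
    proof (rule card_UN_disjoint)
      show "\<forall>B\<in>blocks I. \<forall>B'\<in>blocks I. B \<noteq> B' \<longrightarrow> induced K B \<inter> induced K B' = {}"
      proof (intro ballI impI equals0I)
        fix B B' e assume "B \<in> blocks I" "B' \<in> blocks I" "B \<noteq> B'" "e \<in> induced K B \<inter> induced K B'"
        then show False using edge_in_one_block[OF I(2), of B B' e] KE by (auto simp: induced_def)
      qed
    qed (use finite_blocks finite_induced[OF KE] in auto)
    finally have "card (K \<inter> ?U) = (\<Sum>B\<in>blocks I. card (induced K B))" .
    moreover have "card K = card (K - ?U) + card (K \<inter> ?U)"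
      using fin by (metis Int_commute card_Diff_subset_Int card_mono finite_Int inf_le1 le_add_diff_inverse2)
    ultimately show ?thesis by simp
  qed
  have "J - ?U \<subseteq> I - ?U"
  proof
    fix e assume e: "e \<in> J - ?U"
    then have "e \<in> A" "e \<in> E" using J A by auto
    then show "e \<in> I - ?U" using dependent_in_block[OF I(2), of e] max[of e] e by auto
  qed
  then have "card (J - ?U) \<le> card (I - ?U)"
    using finite_sub I A by (intro card_mono) auto
  moreover have "(\<Sum>B\<in>blocks I. card (induced I B)) = (\<Sum>B\<in>blocks I. \<beta> (card B))"
    by (intro sum.cong) (auto simp: blocks_def tight_def)
  ultimately show ?thesis using split[OF J] split[OF I(1)] by simp
qed

lemma indep_subset: "indep I \<Longrightarrow> J \<subseteq> I \<Longrightarrow> indep J"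
proof -
  assume I: "indep I" and J: "J \<subseteq> I"
  have "card (induced J X) \<le> \<beta> (card X)" if X: "X \<subseteq> V" for X
  proof -
    have "card (induced J X) \<le> card (induced I X)"
      using I J by (intro card_mono induced_mono finite_induced) (auto simp: indep_def)
    also have "\<dots> \<le> \<beta> (card X)" using I X by (simp add: indep_def)
    finally show ?thesis .
  qed
  then show "indep J" using I J by (auto simp: indep_def)
qed

sublocale matroid E indep
proof
  show "finite E" by (rule finite_E)
  show "indep {}" by (simp add: indep_def induced_def)
  show "indep J" if "indep I" "J \<subseteq> I" for I J using that by (rule indep_subset)
  show "card J \<le> card I" if "A \<subseteq> E" "I \<subseteq> A" "indep I" "\<And>x. x \<in> A - I \<Longrightarrow> \<not> indep (insert x I)"
    "J \<subseteq> A" "indep J" for A I J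
  proof -
    have "(\<Sum>B\<in>blocks I. card (induced J B)) \<le> (\<Sum>B\<in>blocks I. \<beta> (card B))"
      using that(6) by (intro sum_mono) (auto simp: indep_def blocks_def tight_def)
    then show ?thesis using card_le_blocks[OF that(1-5)] by linarith
  qed
qed

end

lemma count_function_forest: "count_function (\<lambda>n. n - 1) 2"
proof
  show "n - 1 = n choose 2" if "n < 2" for n :: nat
    using that by (cases n) (auto simp: numeral_2_eq_2)
qed auto

section \<open>Decomposition into a forest and a count-independent set\<close>

text \<open>For the rank condition, the edges of \<open>A\<close> are split along the components
  \<open>W\<close> of a maximal forest. In each component a maximal independent set for
  \<open>\<beta>\<close> leaves out fewer than \<open>card W\<close> edges, and these sets can be
  united because \<open>\<beta>\<close> is superadditive.\<close>

theorem forest_count_decomposition: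
  fixes m :: real
  assumes graph: "edge_set V E" and count: "count_function \<beta> n0" and m: "1 \<le> m"
    and dens: "\<And>X. X \<subseteq> V \<Longrightarrow> card (induced E X) \<le> m * card X"
    and hall: "\<And>X. X \<subseteq> V \<Longrightarrow> n0 \<le> card X \<Longrightarrow>
      (m - 1) * (real (card (induced E X)) - \<beta> (card X)) < \<beta> (card X)"
  shows "\<exists>F I. F \<union> I = E \<and> F \<inter> I = {} \<and>
    (\<forall>X\<subseteq>V. card (induced F X) \<le> card X - 1) \<and> (\<forall>X\<subseteq>V. card (induced I X) \<le> \<beta> (card X))"
proof -
  define \<phi> :: "nat \<Rightarrow> nat" where "\<phi> = (\<lambda>n. n - 1)"
  have \<phi>: "\<phi> n = n - 1" for n by (simp add: \<phi>_def)
  interpret M1: count_matroid V E \<phi> 2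
    using graph count_function_forest unfolding \<phi>_def by (rule count_matroid.intro)
  interpret M2: count_matroid V E \<beta> n0
    using graph count by (rule count_matroid.intro)
  have "card A \<le> M1.rank A + M2.rank A" if A: "A \<subseteq> E" for A
  proof -
    obtain F where F: "M1.basis A F" using M1.basis_exists[OF A] .
    then have FA: "F \<subseteq> A" and Find: "M1.indep F" and Fmax: "\<And>x. x \<in> A - F \<Longrightarrow> \<not> M1.indep (insert x F)"
      by (auto simp: M1.basis_def)
    have FE: "F \<subseteq> E" using FA A by auto
    let ?W = "M1.blocks F"
    have WV: "W \<subseteq> V" and W2: "2 \<le> card W" and Wc: "card (induced F W) = card W - 1"
      if "W \<in> ?W" for W using that by (auto simp: M1.blocks_def M1.tight_def \<phi>)
    have finW: "finite W" if "W \<in> ?W" for W using WV[OF that] M1.finite_V finite_subset by auto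
    \<comment> \<open>For the bound \<open>n - 1\<close> a single common vertex already makes the
      union tight, so distinct components are disjoint; \<open>tight_Un\<close> would need two
      common vertices.\<close>
    have disj: "W = W'" if W: "W \<in> ?W" "W' \<in> ?W" and ne: "W \<inter> W' \<noteq> {}" for W W'
    proof -
      have fin: "finite W" "finite W'" using W finW by auto
      have j: "card (W \<inter> W') > 0" using ne fin by (simp add: card_gt_0_iff)
      have "card (induced F (W \<inter> W')) \<le> card (W \<inter> W') - 1"
        using Find WV[OF W(1)] by (auto simp: M1.indep_def \<phi> le_infI1)
      moreover have "card (induced F W) + card (induced F W')
          \<le> card (induced F (W \<union> W')) + card (induced F (W \<inter> W'))"
        by (rule card_induced_supermodular[OF M1.finite_sub[OF FE]])
      moreover have "card W + card W' = card (W \<union> W') + card (W \<inter> W')"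
        by (rule card_Un_Int[OF fin])
      moreover have "card (induced F (W \<union> W')) \<le> card (W \<union> W') - 1"
        using Find WV W by (auto simp: M1.indep_def \<phi>)
      moreover have "2 \<le> card (W \<union> W')" using W2[OF W(1)] fin card_mono[of "W \<union> W'" W] by auto
      ultimately have "M1.tight F (W \<union> W')"
        using Wc W2 WV W j unfolding M1.tight_def \<phi> by auto
      then have "W \<union> W' = W" "W \<union> W' = W'" using W unfolding M1.blocks_def by blast+
      then show ?thesis by simp
    qed
    \<comment> \<open>An edge of \<open>F\<close> is itself a tight set of two vertices; any other
      edge of \<open>A\<close> is in a block by maximality of \<open>F\<close>.\<close>
    have cover: "\<exists>W\<in>?W. e \<subseteq> W" if e: "e \<in> A" for e
    proof (cases "e \<in> F")
      case True
      then have e2: "e \<subseteq> V" "card e = 2" using FE M1.edge by auto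
      have "card {e} \<le> card (induced F e)"
        using True M1.finite_induced[OF FE] by (intro card_mono) (auto simp: induced_def)
      moreover have "card (induced F e) \<le> card e - 1" using Find e2(1) unfolding M1.indep_def \<phi> by blast
      ultimately have "M1.tight F e" using e2 by (simp add: M1.tight_def \<phi>)
      then obtain B where "B \<in> ?W" "e \<subseteq> B" by (rule M1.tight_in_block)
      then show ?thesis by auto
    next
      case False
      then show ?thesis using M1.dependent_in_block[OF Find, of e] Fmax[of e] e A by auto
    qed
    have one: "W = W'" if "W \<in> ?W" "W' \<in> ?W" "e \<in> A" "e \<subseteq> W" "e \<subseteq> W'" for W W' e
      using M1.edge_in_one_block[OF Find that(1,2) _ that(4,5)] that(3) A by auto
    have finWs: "finite ?W" by (rule M1.finite_blocks)
    have AWE: "induced A W \<subseteq> E" for W using A by (auto simp: induced_def)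
    have "\<forall>W\<in>?W. \<exists>I. M2.basis (induced A W) I" using M2.basis_exists[OF AWE] by metis
    then obtain K where K: "\<And>W. W \<in> ?W \<Longrightarrow> M2.basis (induced A W) (K W)" by metis
    have KA: "K W \<subseteq> induced A W" and Kind: "M2.indep (K W)"
      and Kmax: "\<And>x. x \<in> induced A W - K W \<Longrightarrow> \<not> M2.indep (insert x (K W))" if "W \<in> ?W" for W
      using K[OF that] by (auto simp: M2.basis_def)
    \<comment> \<open>If the number \<open>a\<close> of left over edges were at least
      \<open>card W\<close>, the density would give \<open>card (K W) \<le> (m - 1) * a\<close>.
      Summing \<open>hall\<close> over the blocks of \<open>K W\<close> gives the strict
      opposite.\<close>
    have local: "card (induced A W) \<le> card (K W) + (card W - 1)" if W: "W \<in> ?W" for W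
    proof (rule ccontr)
      assume "\<not> ?thesis"
      then have a: "real (card W) \<le> real (card (induced A W)) - card (K W)" using W2[OF W] by linarith
      let ?B = "M2.blocks (K W)"
      define a where "a = real (card (induced A W)) - card (K W)"
      have "card (induced A W) + (\<Sum>B\<in>?B. \<beta> (card B))
          \<le> card (K W) + (\<Sum>B\<in>?B. card (induced (induced A W) B))"
        by (rule M2.card_le_blocks[OF AWE KA[OF W] Kind[OF W] Kmax[OF W]]) auto
      then have "real (card (induced A W) + (\<Sum>B\<in>?B. \<beta> (card B)))
          \<le> real (card (K W) + (\<Sum>B\<in>?B. card (induced (induced A W) B)))" by (rule of_nat_mono)
      then have aB: "a \<le> (\<Sum>B\<in>?B. real (card (induced (induced A W) B)) - \<beta> (card B))"
        by (simp add: a_def sum_subtractf)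
      have lt: "(m - 1) * (real (card (induced (induced A W) B)) - \<beta> (card B)) < \<beta> (card B)"
        if B: "B \<in> ?B" for B
      proof -
        have BV: "B \<subseteq> V" "n0 \<le> card B" using B by (auto simp: M2.blocks_def M2.tight_def)
        have "card (induced (induced A W) B) \<le> card (induced E B)"
          using AWE by (intro card_mono M1.finite_induced induced_mono) auto
        then have "(m - 1) * (real (card (induced (induced A W) B)) - \<beta> (card B))
            \<le> (m - 1) * (real (card (induced E B)) - \<beta> (card B))"
          using m by (intro mult_left_mono) auto
        then show ?thesis using hall[OF BV] by linarith
      qed
      have "card (induced A W) \<le> card (induced E W)"
        using A by (intro card_mono M1.finite_induced induced_mono) auto
      then have "real (card (induced A W)) \<le> m * card W" using dens[OF WV[OF W]] by linarith
      also have "\<dots> \<le> m * a" using a m by (intro mult_left_mono) (auto simp: a_def)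
      finally have KW: "card (K W) \<le> (m - 1) * a" by (simp add: a_def algebra_simps)
      have apos: "a > 0" using a W2[OF W] by (simp add: a_def)
      \<comment> \<open>Strictness of the summed inequality needs a block; \<open>a > 0\<close>
        provides one.\<close>
      then have ne: "?B \<noteq> {}" using aB by auto
      have "(m - 1) * a \<le> (\<Sum>B\<in>?B. (m - 1) * (real (card (induced (induced A W) B)) - \<beta> (card B)))"
        using mult_left_mono[OF aB, of "m - 1"] m by (simp add: sum_distrib_left)
      also have "\<dots> < (\<Sum>B\<in>?B. real (\<beta> (card B)))"
        using lt ne M2.finite_blocks by (intro sum_strict_mono) auto
      also have "\<dots> = real (\<Sum>B\<in>?B. card (induced (K W) B))"
        by (simp add: M2.blocks_def M2.tight_def)
      also have "(\<Sum>B\<in>?B. card (induced (K W) B)) \<le> card (K W)"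
      proof -
        have KE: "K W \<subseteq> E" using KA[OF W] AWE by auto
        have "(\<Sum>B\<in>?B. card (induced (K W) B)) = card (\<Union>B\<in>?B. induced (K W) B)"
        proof (rule card_UN_disjoint[symmetric])
          show "\<forall>B\<in>?B. \<forall>B'\<in>?B. B \<noteq> B' \<longrightarrow> induced (K W) B \<inter> induced (K W) B' = {}"
          proof (intro ballI impI equals0I)
            fix B B' e assume "B \<in> ?B" "B' \<in> ?B" "B \<noteq> B'" "e \<in> induced (K W) B \<inter> induced (K W) B'"
            then show False using M2.edge_in_one_block[OF Kind[OF W], of B B' e] KE
              by (auto simp: induced_def)
          qed
        qed (use M2.finite_blocks M1.finite_induced[OF KE] in auto)
        also have "\<dots> \<le> card (K W)"
          using M1.finite_sub[OF KE] by (intro card_mono) (auto simp: induced_def)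
        finally show ?thesis .
      qed
      finally show False using KW by simp
    qed
    define I where "I = (\<Union>W\<in>?W. K W)"
    have IA: "I \<subseteq> A" using KA by (auto simp: I_def induced_def)
    have IE: "I \<subseteq> E" using IA A by auto
    have cardU: "card (\<Union>W\<in>?W. S W) = (\<Sum>W\<in>?W. card (S W))"
      if S: "\<And>W. W \<in> ?W \<Longrightarrow> S W \<subseteq> induced A W" for S
    proof (rule card_UN_disjoint)
      show "\<forall>W\<in>?W. finite (S W)" using S M1.finite_induced[OF A] finite_subset by blast
      show "\<forall>W\<in>?W. \<forall>W'\<in>?W. W \<noteq> W' \<longrightarrow> S W \<inter> S W' = {}"
      proof (intro ballI impI equals0I)
        fix W W' e assume "W \<in> ?W" "W' \<in> ?W" "W \<noteq> W'" "e \<in> S W \<inter> S W'"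
        then show False using S[of W] S[of W'] one[of W W' e] by (auto simp: induced_def)
      qed
    qed (rule finWs)
    \<comment> \<open>The components cut \<open>X\<close> into disjoint pieces, so superadditivity
      bounds the sum of the local bounds by that of \<open>X\<close>.\<close>
    have "M2.indep I" unfolding M2.indep_def
    proof (intro conjI allI impI)
      fix X assume X: "X \<subseteq> V"
      have finX: "finite X" using X M1.finite_V finite_subset by auto
      have "induced I X \<subseteq> (\<Union>W\<in>?W. induced (K W) (X \<inter> W))"
        using KA by (fastforce simp: I_def induced_def)
      moreover have fin: "finite (induced (K W) (X \<inter> W))" if "W \<in> ?W" for W
        using KA[OF that] AWE by (intro M1.finite_induced) auto
      ultimately have "card (induced I X) \<le> card (\<Union>W\<in>?W. induced (K W) (X \<inter> W))"
        using finWs by (intro card_mono) auto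
      also have "\<dots> \<le> (\<Sum>W\<in>?W. card (induced (K W) (X \<inter> W)))"
        by (rule card_UN_le[OF finWs])
      also have "\<dots> \<le> (\<Sum>W\<in>?W. \<beta> (card (X \<inter> W)))"
        using Kind X by (intro sum_mono) (auto simp: M2.indep_def le_infI1)
      also have "\<dots> \<le> \<beta> (\<Sum>W\<in>?W. card (X \<inter> W))" by (rule M2.\<beta>_sum[OF finWs])
      also have "(\<Sum>W\<in>?W. card (X \<inter> W)) = card (\<Union>W\<in>?W. X \<inter> W)"
        using finWs finX disj by (intro card_UN_disjoint[symmetric]) auto
      also have "\<beta> \<dots> \<le> \<beta> (card X)"
        using finX by (intro M2.\<beta>_mono card_mono) auto
      finally show "card (induced I X) \<le> \<beta> (card X)" .
    qed (rule IE)
    then have r2: "card I \<le> M2.rank A" using IA A by (intro M2.card_le_rank)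
    have r1: "M1.rank A = card F" by (rule M1.rank_basis[OF A F])
    have "A = (\<Union>W\<in>?W. induced A W)" using cover by (auto simp: induced_def)
    then have "card A = (\<Sum>W\<in>?W. card (induced A W))" using cardU[of "induced A"] by simp
    also have "\<dots> \<le> (\<Sum>W\<in>?W. card (K W) + (card W - 1))" by (rule sum_mono[OF local])
    also have "\<dots> = card I + (\<Sum>W\<in>?W. card (induced F W))"
      using cardU[OF KA] Wc by (simp add: I_def sum.distrib)
    also have "(\<Sum>W\<in>?W. card (induced F W)) = card (\<Union>W\<in>?W. induced F W)"
      using FA by (intro cardU[symmetric] induced_mono) auto
    also have "\<dots> \<le> card F"
      using M1.finite_sub[OF FE] by (intro card_mono) (auto simp: induced_def)
    finally show ?thesis using r1 r2 by simp
  qed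
  then have "partitionable E M1.rank M2.rank"
    by (rule matroid_partition[OF M1.finite_E M1.rank_function_rank M2.rank_function_rank])
  then obtain F I where FI: "F \<union> I = E" "F \<inter> I = {}" "M1.rank F = card F" "M2.rank I = card I"
    unfolding partitionable_def by auto
  have "F \<subseteq> E" "I \<subseteq> E" using FI(1) by auto
  then have "M1.indep F" "M2.indep I"
    using M1.indep_iff_rank M2.indep_iff_rank FI(3,4) by auto
  then show ?thesis using FI(1,2) unfolding M1.indep_def M2.indep_def \<phi> by blast
qed

section \<open>An integral bound for a real density\<close>

lemma real_choose_two: "real (n choose 2) = real n * (real n - 1) / 2"
proof -
  have "even (n * (n - 1))" by (cases n) auto
  then have "real (n choose 2) = real (n * (n - 1)) / 2"
    by (simp add: choose_two real_of_nat_div)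
  then show ?thesis by (cases n) (auto simp: algebra_simps)
qed

text \<open>The line \<open>P n = k * (n - 2) + 1 + s\<close> is modular, so only deviations from it
  matter: \<open>\<beta>\<close> is at least \<open>2 * D\<close> below the line for sizes from 2 to
  \<open>n0 - 1\<close>, exactly \<open>D\<close> below it at \<open>n0\<close>, and on it beyond.
  The assumption \<open>s + 1 \<le> 2 * k\<close> makes the line superadditive.\<close>

lemma count_function_linear:
  fixes k s D n0 :: nat
  defines "\<beta> \<equiv> \<lambda>n. if n < n0 then n choose 2 else k * (n - 2) + 1 + s - (if n = n0 then D else 0)"
  assumes n0: "2 \<le> n0" and k: "1 \<le> k" and D: "D \<le> 1" and s: "s + 1 \<le> 2 * k"
    and cap: "\<And>j. 2 \<le> j \<Longrightarrow> j < n0 \<Longrightarrow> (j choose 2) + 2 * D \<le> k * (j - 2) + 1 + s"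
  shows "count_function \<beta> n0"
proof
  define P where "P n = k * (n - 2) + 1 + s" for n
  have \<beta>_small: "\<beta> n + 2 * D \<le> P n" if "2 \<le> n" "n < n0" for n
    using cap that by (simp add: \<beta>_def P_def)
  have \<beta>_n0: "\<beta> n0 + D = P n0" using D by (simp add: \<beta>_def P_def)
  have \<beta>_big: "\<beta> n = P n" if "n0 < n" for n using that by (simp add: \<beta>_def P_def)
  have \<beta>_le: "\<beta> n \<le> P n" if "2 \<le> n" for n
    using \<beta>_small \<beta>_n0 \<beta>_big that by (metis add_leD1 le_refl linorder_neqE_nat)
  have \<beta>_ge: "P n \<le> \<beta> n + D" if "n0 \<le> n" for n
    using \<beta>_n0 \<beta>_big that by (cases "n = n0") auto
  have \<beta>_01: "\<beta> 0 = 0" "\<beta> (Suc 0) = 0" using n0 by (auto simp: \<beta>_def numeral_2_eq_2)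
  have P_Suc: "P (Suc n) = P n + k" if n: "2 \<le> n" for n
  proof -
    obtain a where "n = a + 2" using n by (metis add.commute le_Suc_ex)
    then show ?thesis by (simp add: P_def)
  qed
  show "\<beta> n = n choose 2" if "n < n0" for n using that by (simp add: \<beta>_def)
  show "\<beta> (x + y - j) + \<beta> j \<le> \<beta> x + \<beta> y"
    if x: "n0 \<le> x" and y: "n0 \<le> y" and j: "2 \<le> j" "j \<le> x" "j \<le> y" for x y j
  proof -
    obtain a b c where abc: "j = a + 2" "x = a + b + 2" "y = a + c + 2"
      using j by (metis add.commute add.assoc le_Suc_ex)
    have lin: "P (x + y - j) + P j = P x + P y"
      unfolding abc P_def by (simp add: algebra_simps)
    show ?thesis
    proof (cases "j < n0")
      case True
      \<comment> \<open>The union is larger than \<open>n0\<close>, so its value is on the line; the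
        gap \<open>2 * D\<close> at \<open>j\<close> pays for a loss of \<open>D\<close> at each of
        \<open>x\<close> and \<open>y\<close>.\<close>
      then have "n0 < x + y - j" using x y j by linarith
      then show ?thesis using lin \<beta>_small[OF j(1) True] \<beta>_ge[OF x] \<beta>_ge[OF y] \<beta>_big by fastforce
    next
      case False
      \<comment> \<open>If \<open>x\<close> or \<open>y\<close> equals \<open>n0\<close>, then
        \<open>j\<close> equals it too and both sides coincide; otherwise the values at
        \<open>x\<close> and \<open>y\<close> are on the line.\<close>
      consider "x = n0" | "y = n0" | "n0 < x" "n0 < y" using x y by linarith
      then show ?thesis
      proof cases
        case 1
        then have "j = x" using False j by simp
        then show ?thesis by simp
      next
        case 2
        then have "j = y" using False j by simp
        then show ?thesis by simp
      next
        case 3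
        have "\<beta> (x + y - j) \<le> P (x + y - j)" "\<beta> j \<le> P j" using \<beta>_le j by auto
        then show ?thesis using lin \<beta>_big 3 by simp
      qed
    qed
  qed
  have step: "\<beta> y \<le> \<beta> (Suc y)" for y
  proof -
    consider "Suc y < n0" | "Suc y = n0" | "n0 \<le> y" by linarith
    then show ?thesis
    proof cases
      case 1
      then show ?thesis by (simp add: \<beta>_def numeral_2_eq_2)
    next
      case 2
      show ?thesis
      proof (cases "2 \<le> y")
        case True
        then show ?thesis using 2 \<beta>_small[of y] \<beta>_n0 P_Suc[of y] k by simp
      next
        case False
        then have "y = 0 \<or> y = Suc 0" by linarith
        then show ?thesis using \<beta>_01 by auto
      qed
    next
      case 3
      then show ?thesis using \<beta>_le[of y] \<beta>_big[of "Suc y"] P_Suc[of y] n0 by simp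
    qed
  qed
  have *: "\<beta> x + \<beta> y \<le> \<beta> (x + y)" if x: "2 \<le> x" and y: "2 \<le> y" for x y
  proof -
    obtain a b where ab: "x = a + 2" "y = b + 2" using x y by (metis add.commute le_Suc_ex)
    have lin: "P x + P y \<le> P (x + y)" unfolding ab P_def using s by (simp add: algebra_simps)
    consider "x + y < n0" | "x + y = n0" | "n0 < x + y" by linarith
    then show ?thesis
    proof cases
      case 1
      have "(x choose 2) + (y choose 2) \<le> (x + y) choose 2"
      proof -
        have "real ((x choose 2) + (y choose 2)) \<le> real ((x + y) choose 2)"
          by (simp add: real_choose_two field_simps)
        then show ?thesis by (simp only: of_nat_le_iff)
      qed
      then show ?thesis using 1 by (simp add: \<beta>_def)
    next
      case 2
      then show ?thesis using lin \<beta>_small[OF x] \<beta>_small[OF y] \<beta>_n0 x y by simp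
    next
      case 3
      then show ?thesis using lin \<beta>_le[OF x] \<beta>_le[OF y] \<beta>_big by simp
    qed
  qed
  show "\<beta> x + \<beta> y \<le> \<beta> (x + y)" for x y
  proof -
    consider "x = 0" | "x = Suc 0" | "y = 0" | "y = Suc 0" | "2 \<le> x" "2 \<le> y" by linarith
    then show ?thesis using * step \<beta>_01 by cases auto
  qed
qed

text \<open>
  The last clause is the inequality \<open>(m - 1) * a(B) < \<beta>(B)\<close> of the counting argument; \<open>e\<close> stands for
  the number of edges spanned by \<open>n\<close> vertices.
\<close>

definition admissible :: "real \<Rightarrow> (nat \<Rightarrow> nat) \<Rightarrow> nat \<Rightarrow> bool" where
  "admissible m \<beta> n0 \<longleftrightarrow> count_function \<beta> n0 \<and>
     (\<forall>n\<ge>2. \<beta> n \<le> m * (real n - 2) + 1) \<and>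
     (\<forall>n\<ge>n0. \<forall>e. e \<le> m * n \<longrightarrow> e \<le> real (n choose 2) \<longrightarrow> (m - 1) * (e - \<beta> n) < \<beta> n)"

text \<open>\<open>upper0\<close> and \<open>upper\<close> keep \<open>\<beta>\<close> below
  \<open>m * (n - 2) + 1\<close> at \<open>n0\<close> and beyond. In the last clause the edge number
  is bounded by the binomial for sizes \<open>n0\<close> and \<open>n0 + 1\<close>
  (\<open>at0\<close>, \<open>at1\<close>) and by \<open>m * n\<close> from \<open>n0 + 2\<close>
  on, where the clause reduces to \<open>(m - 1) * n < \<beta> n\<close>: this holds at
  \<open>n0 + 2\<close> by \<open>large\<close> and persists by \<open>m_lt\<close>.\<close>

lemma admissible_linear:
  fixes k s D n0 :: nat and m :: real
  assumes m: "1 < m" and k: "1 \<le> k" and D: "D \<le> 1" and s: "s + 1 \<le> 2 * k"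
    and n0: "2 \<le> n0" "real n0 \<le> 2 * m" "real k \<le> m"
    and cap: "\<And>j. 2 \<le> j \<Longrightarrow> j < n0 \<Longrightarrow> real (j choose 2) + 2 * real D \<le> real k * (real j - 2) + 1 + real s"
    and upper0: "real s \<le> (m - real k) * (real n0 - 2) + real D" and upper: "real s \<le> (m - real k) * (real n0 - 1)"
    and large: "(real k + 1 - m) * (real n0 + 2) > 2 * real k - 1 - real s" and m_lt: "m < real k + 1"
    and at0: "(m - 1) * (real (n0 choose 2) - (real k * (real n0 - 2) + 1 + real s - real D)) < real k * (real n0 - 2) + 1 + real s - real D"
    and at1: "(m - 1) * (real (Suc n0 choose 2) - (real k * (real n0 - 1) + 1 + real s)) < real k * (real n0 - 1) + 1 + real s"
  shows "\<exists>\<beta>. admissible m \<beta> n0"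
proof -
  define \<beta> where "\<beta> = (\<lambda>n. if n < n0 then n choose 2 else k * (n - 2) + 1 + s - (if n = n0 then D else 0))"
  have cap': "(j choose 2) + 2 * D \<le> k * (j - 2) + 1 + s" if "2 \<le> j" "j < n0" for j
  proof -
    have "real ((j choose 2) + 2 * D) \<le> real (k * (j - 2) + 1 + s)"
      using cap[OF that] that by (simp add: of_nat_diff)
    then show ?thesis by (simp only: of_nat_le_iff)
  qed
  have cf: "count_function \<beta> n0"
    unfolding \<beta>_def by (rule count_function_linear[OF n0(1) k D s cap'])
  have \<beta>0: "real (\<beta> n0) = k * (real n0 - 2) + 1 + s - D"
    using n0 D by (simp add: \<beta>_def of_nat_diff)
  have \<beta>1: "real (\<beta> n) = k * (real n - 2) + 1 + s" if "n0 < n" for n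
    using n0 that by (simp add: \<beta>_def of_nat_diff)
  have up: "\<beta> n \<le> m * (real n - 2) + 1" if n: "2 \<le> n" for n
  proof -
    consider "n < n0" | "n = n0" | "n0 < n" by linarith
    then show ?thesis
    proof cases
      case 1
      then have "real n + 1 \<le> 2 * m" using n0 by linarith
      \<comment> \<open>The left side is \<open>2 * ((n choose 2) - 1)\<close>, so this is the
        required bound for complete graphs.\<close>
      then have "(real n - 2) * (real n + 1) \<le> (real n - 2) * (2 * m)"
        using n by (intro mult_left_mono) auto
      then show ?thesis using 1 by (simp add: \<beta>_def real_choose_two field_simps)
    next
      case 2
      then show ?thesis using \<beta>0 upper0 by (simp add: algebra_simps)
    next
      case 3
      then have "(m - k) * (real n0 - 1) \<le> (m - k) * (real n - 2)"
        using n0 by (intro mult_left_mono) auto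
      then show ?thesis using \<beta>1[OF 3] upper by (simp add: algebra_simps)
    qed
  qed
  have hall: "(m - 1) * (e - \<beta> n) < \<beta> n" if n: "n0 \<le> n" and e: "e \<le> m * n" "e \<le> real (n choose 2)" for n e
  proof -
    consider "n = n0" | "n = Suc n0" | "n0 + 2 \<le> n" using n by linarith
    then show ?thesis
    proof cases
      case 1
      have "(m - 1) * (e - \<beta> n) \<le> (m - 1) * (real (n choose 2) - \<beta> n)"
        using e m by (intro mult_left_mono) auto
      then show ?thesis using at0 1 \<beta>0 by simp
    next
      case 2
      have "(m - 1) * (e - \<beta> n) \<le> (m - 1) * (real (n choose 2) - \<beta> n)"
        using e m by (intro mult_left_mono) auto
      moreover have "real (\<beta> n) = k * (real n0 - 1) + 1 + s" using \<beta>1[of n] 2 by simp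
      ultimately show ?thesis using at1 2 by simp
    next
      case 3
      have "(real k + 1 - m) * (real n0 + 2) \<le> (real k + 1 - m) * real n"
        using 3 m_lt by (intro mult_left_mono) auto
      then have "(m - 1) * n < \<beta> n" using large \<beta>1[of n] 3 by (simp add: algebra_simps)
      then have "m * ((m - 1) * n) < m * \<beta> n" using m by (intro mult_strict_left_mono) auto
      moreover have "(m - 1) * (e - \<beta> n) \<le> (m - 1) * (m * n - \<beta> n)"
        using e m by (intro mult_left_mono) auto
      ultimately show ?thesis by (simp add: algebra_simps)
    qed
  qed
  show ?thesis using cf up hall unfolding admissible_def by blast
qed

text \<open>
  The linear part \<open>k * (n - 2) + 1 + s\<close> must stay below \<open>m * (n - 2) + 1\<close> from \<open>n0\<close> on, which suggests
  \<open>s = \<lfloor>(m - k) * (n0 - 2)\<rfloor>\<close>. When \<open>m\<close> is slightly below an integer this is too small for the last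
  clause of admissibility; then \<open>s\<close> is raised by one and the bound at \<open>n0\<close> itself is lowered by
  \<open>D = 1\<close>, which preserves submodularity.
\<close>

lemma admissible_exists:
  fixes m :: real
  assumes m: "1 < m" and not_special: "m < 9 / 5 \<or> 2 \<le> m"
  shows "\<exists>\<beta> n0. admissible m \<beta> n0"
proof -
  define k where "k = nat \<lfloor>m\<rfloor>"
  define \<epsilon> where "\<epsilon> = m - k"
  have "real k = of_int \<lfloor>m\<rfloor>" using m by (simp add: k_def)
  then have \<epsilon>: "0 \<le> \<epsilon>" "\<epsilon> < 1" by (simp_all add: \<epsilon>_def) linarith+
  have mk: "m = k + \<epsilon>" by (simp add: \<epsilon>_def)
  have k1: "1 \<le> k" using m \<epsilon> mk by linarith
  have k1': "1 \<le> real k" using k1 by simp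
  have floor: "\<exists>s::nat. s \<le> x \<and> x < real s + 1" if "0 \<le> x" for x :: real
    using that by (intro exI[of _ "nat \<lfloor>x\<rfloor>"]) auto
  have small_clique: "real (j choose 2) \<le> k * (real j - 2) + 1" if j: "2 \<le> j" "j < 2 * k" for j
  proof -
    have "(real j - 2) * (real j + 1) \<le> (real j - 2) * (2 * k)"
      using j by (intro mult_left_mono) auto
    then show ?thesis by (simp add: real_choose_two field_simps)
  qed
  show ?thesis
  proof (cases "\<epsilon> < 1 / 2")
    case True
    \<comment> \<open>Here \<open>\<lfloor>2 * m\<rfloor> = 2 * k\<close>, so
      \<open>n0 = 2 * k\<close> and \<open>s\<close> is the integer part of
      \<open>\<epsilon> * (n0 - 2)\<close>.\<close>
    have "0 \<le> \<epsilon> * (2 * real k - 2)" using \<epsilon> k1' by simp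
    from floor[OF this] obtain s :: nat where s: "s \<le> \<epsilon> * (2 * real k - 2)" "\<epsilon> * (2 * real k - 2) < real s + 1"
      by (elim exE conjE)
    have "\<epsilon> * (2 * real k - 2) \<le> 1 / 2 * (2 * real k - 2)" using True k1' by (intro mult_right_mono) auto
    then have sk: "real s \<le> real k - 1" using s by simp
    have "\<exists>\<beta>. admissible m \<beta> (2 * k)"
    proof (rule admissible_linear[where k = k and s = s and D = 0])
      show "s + 1 \<le> 2 * k" using sk k1' by linarith
      show "real (j choose 2) + 2 * real 0 \<le> k * (real j - 2) + 1 + s" if "2 \<le> j" "j < 2 * k" for j
        using small_clique[OF that] by simp
      show "s \<le> (m - k) * (real (2 * k) - 2) + real 0" using s by (simp add: \<epsilon>_def)
      show "s \<le> (m - k) * (real (2 * k) - 1)"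
        using s(1) \<epsilon>(1) by (simp add: mk algebra_simps)
      show "(real k + 1 - m) * (real (2 * k) + 2) > 2 * real k - 1 - s"
        using s(2) True by (simp add: mk algebra_simps)
      have "(m - 1) * (real (2 * k choose 2) - (k * (real (2 * k) - 2) + 1 + s - real 0))
          \<le> (m - 1) * (real k - 1)"
        using m by (intro mult_left_mono) (auto simp: real_choose_two field_simps)
      also have "\<dots> \<le> k * (real k - 1)" using mk \<epsilon> k1' by (intro mult_right_mono) auto
      also have "\<dots> < k * (real (2 * k) - 2) + 1 + s - real 0"
      proof -
        have "0 \<le> real k * (real k - 1)" using k1' by simp
        moreover have "real k * (real (2 * k) - 2) = 2 * (real k * (real k - 1))"
          by (simp add: algebra_simps)
        ultimately show ?thesis by linarith
      qed
      finally show "(m - 1) * (real (2 * k choose 2) - (k * (real (2 * k) - 2) + 1 + s - real 0))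
          < k * (real (2 * k) - 2) + 1 + s - real 0" .
      have "(m - 1) * (real (Suc (2 * k) choose 2) - (k * (real (2 * k) - 1) + 1 + s))
          \<le> (m - 1) * (2 * real k - 1)"
        using m by (intro mult_left_mono) (auto simp: real_choose_two field_simps)
      also have "\<dots> \<le> (real k - 1 / 2) * (2 * real k - 1)" using mk True k1' by (intro mult_right_mono) auto
      also have "\<dots> < k * (real (2 * k) - 1) + 1 + s"
        using k1' by (simp add: algebra_simps)
      finally show "(m - 1) * (real (Suc (2 * k) choose 2) - (k * (real (2 * k) - 1) + 1 + s))
          < k * (real (2 * k) - 1) + 1 + s" .
    qed (use m k1 mk \<epsilon> in auto)
    then show ?thesis by blast
  next
    case False
    \<comment> \<open>Now \<open>\<lfloor>2 * m\<rfloor> = 2 * k + 1\<close>, so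
      \<open>n0 - 2\<close> becomes \<open>2 * k - 1\<close>.\<close>
    then have half: "1 / 2 \<le> \<epsilon>" by simp
    have "0 \<le> \<epsilon> * (2 * real k - 1)" using \<epsilon> k1' by simp
    from floor[OF this] obtain s :: nat where s: "s \<le> \<epsilon> * (2 * real k - 1)" "\<epsilon> * (2 * real k - 1) < real s + 1"
      by (elim exE conjE)
    have "1 / 2 * (2 * real k - 1) \<le> \<epsilon> * (2 * real k - 1)" using half k1' by (intro mult_right_mono) auto
    then have "real k < real (s + 2)" using s by simp
    then have "k \<le> s + 1" by linarith
    then have sk: "real k - 1 \<le> s" by linarith
    have "\<epsilon> * (2 * real k - 1) < 1 * (2 * real k - 1)" using \<epsilon> k1' by (intro mult_strict_right_mono) auto
    with s(1) have "real s < 1 * (2 * real k - 1)" by (rule le_less_trans)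
    then have "real (s + 1) < real (2 * k)" by simp
    then have s2k: "s + 2 \<le> 2 * k" by linarith
    \<comment> \<open>At \<open>j = 2 * k\<close> the binomial equals
      \<open>k * (j - 2) + k\<close>. The cap there asks for \<open>k - 1 \<le> s\<close> when
      \<open>D = 0\<close>, and for \<open>k \<le> s\<close> when \<open>D = 1\<close> and
      \<open>s\<close> is raised by one.\<close>
    have small: "real (j choose 2) \<le> k * (real j - 2) + s + (if j = 2 * k then (real k - s) else 1)"
      if j: "2 \<le> j" "j < 2 * k + 1" for j
    proof (cases "j = 2 * k")
      case True
      then show ?thesis by (simp add: real_choose_two field_simps)
    next
      case False
      then show ?thesis using small_clique[of j] j by simp
    qed
    have at0: "(m - 1) * (real (2 * k + 1 choose 2) - (k * (real (2 * k + 1) - 2) + 1 + s))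
          < k * (real (2 * k + 1) - 2) + 1 + s"
    proof -
      have "(m - 1) * (real (2 * k + 1 choose 2) - (k * (real (2 * k + 1) - 2) + 1 + s)) \<le> (m - 1) * k"
        using m sk by (intro mult_left_mono) (auto simp: real_choose_two field_simps)
      also have "\<dots> \<le> real k * k" using mk \<epsilon> k1' by (intro mult_right_mono) auto
      also have "\<dots> < k * (real (2 * k + 1) - 2) + 1 + s"
      proof -
        have "0 < real k * real k" using k1' by simp
        moreover have "real k * (real (2 * k + 1) - 2) = 2 * (real k * real k) - real k"
          by (simp add: algebra_simps)
        ultimately show ?thesis using sk by linarith
      qed
      finally show ?thesis .
    qed
    show ?thesis
    \<comment> \<open>The condition is a rearrangement of the assumption \<open>large\<close> of
      \<open>admissible_linear\<close> for this \<open>s\<close> and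
      \<open>n0 = 2 * k + 1\<close>.\<close>
    proof (cases "\<epsilon> * (2 * real k - 1) - s < 4 * (1 - \<epsilon>)")
      case True
      have "\<exists>\<beta>. admissible m \<beta> (2 * k + 1)"
      proof (rule admissible_linear[where k = k and s = s and D = 0])
        show "real (j choose 2) + 2 * real 0 \<le> k * (real j - 2) + 1 + s" if "2 \<le> j" "j < 2 * k + 1" for j
          using small[OF that] sk by (auto split: if_splits)
        show "s \<le> (m - k) * (real (2 * k + 1) - 2) + real 0" using s by (simp add: mk)
        show "s \<le> (m - k) * (real (2 * k + 1) - 1)"
          using s(1) \<epsilon>(1) by (simp add: mk algebra_simps)
        show "(real k + 1 - m) * (real (2 * k + 1) + 2) > 2 * real k - 1 - s"
          using s(2) True by (simp add: mk algebra_simps)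
        show "(m - 1) * (real (2 * k + 1 choose 2) - (k * (real (2 * k + 1) - 2) + 1 + s - real 0))
          < k * (real (2 * k + 1) - 2) + 1 + s - real 0" using at0 by simp
        show "(m - 1) * (real (Suc (2 * k + 1) choose 2) - (k * (real (2 * k + 1) - 1) + 1 + s))
          < k * (real (2 * k + 1) - 1) + 1 + s"
        proof -
          have "(m - 1) * (real (Suc (2 * k + 1) choose 2) - (k * (real (2 * k + 1) - 1) + 1 + s))
              \<le> (m - 1) * (2 * real k + 1)"
            using m sk by (intro mult_left_mono) (auto simp: real_choose_two field_simps)
          also have "\<dots> < k * (2 * real k + 1)" using mk \<epsilon> by (intro mult_strict_right_mono) auto
          also have "\<dots> \<le> k * (real (2 * k + 1) - 1) + 1 + s" using sk by (simp add: algebra_simps)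
          finally show ?thesis .
        qed
      qed (use m k1 mk \<epsilon> half s2k in auto)
      then show ?thesis by blast
    next
      case bad: False
      have e34: "3 / 4 < \<epsilon>" using bad s by (simp add: algebra_simps)
      \<comment> \<open>For \<open>k = 1\<close> also \<open>s = 0\<close>, and the failed condition
        reads \<open>5 * \<epsilon> \<ge> 4\<close>, that is \<open>m \<ge> 9 / 5\<close>: this is
        the origin of the excluded range.\<close>
      have k2: "2 \<le> k"
      proof (rule ccontr)
        assume "\<not> 2 \<le> k"
        then have "k = 1" using k1 by simp
        moreover have "s = 0" using s2k \<open>k = 1\<close> by simp
        ultimately show False using bad mk not_special \<epsilon> by simp
      qed
      have "real k \<le> 3 / 4 * (2 * real k - 1)" using k2 by simp
      also have "\<dots> \<le> \<epsilon> * (2 * real k - 1)" using e34 k1' by (intro mult_right_mono) auto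
      also have "\<dots> < real s + 1" by (rule s(2))
      finally have sk': "k \<le> s" by linarith
      have "\<exists>\<beta>. admissible m \<beta> (2 * k + 1)"
      proof (rule admissible_linear[where k = k and s = "s + 1" and D = 1])
        show "real (j choose 2) + 2 * real 1 \<le> k * (real j - 2) + 1 + real (s + 1)"
          if "2 \<le> j" "j < 2 * k + 1" for j
          using small[OF that] small_clique[of j] that sk' k2 by (cases "j = 2 * k") auto
        show "real (s + 1) \<le> (m - k) * (real (2 * k + 1) - 2) + real 1" using s by (simp add: mk)
        show "real (s + 1) \<le> (m - k) * (real (2 * k + 1) - 1)"
          using bad \<epsilon> by (simp add: mk algebra_simps)
        show "(real k + 1 - m) * (real (2 * k + 1) + 2) > 2 * real k - 1 - real (s + 1)"
          using s(2) \<epsilon> by (simp add: mk algebra_simps)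
        show "(m - 1) * (real (2 * k + 1 choose 2) - (k * (real (2 * k + 1) - 2) + 1 + real (s + 1) - real 1))
          < k * (real (2 * k + 1) - 2) + 1 + real (s + 1) - real 1" using at0 by (simp add: add_ac)
        show "(m - 1) * (real (Suc (2 * k + 1) choose 2) - (k * (real (2 * k + 1) - 1) + 1 + real (s + 1)))
          < k * (real (2 * k + 1) - 1) + 1 + real (s + 1)"
        proof -
          have "(m - 1) * (real (Suc (2 * k + 1) choose 2) - (k * (real (2 * k + 1) - 1) + 1 + real (s + 1)))
              \<le> (m - 1) * (2 * real k)"
            using m sk' by (intro mult_left_mono) (auto simp: real_choose_two field_simps)
          also have "\<dots> \<le> k * (2 * real k)" using mk \<epsilon> by (intro mult_right_mono) auto
          also have "\<dots> < k * (real (2 * k + 1) - 1) + 1 + real (s + 1)" by (simp add: algebra_simps)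
          finally show ?thesis .
        qed
      qed (use m k1 mk \<epsilon> half s2k in auto)
      then show ?thesis by blast
    qed
  qed
qed

section \<open>Densities between 9/5 and 2\<close>

definition closes_triangle :: "'a set set \<Rightarrow> 'a set \<Rightarrow> bool" where
  "closes_triangle T e \<longleftrightarrow> (\<exists>a b c. e = {a, b} \<and> {a, c} \<in> T \<and> {c, b} \<in> T)"

context edge_set
begin

lemma finite_vertices: "X \<subseteq> V \<Longrightarrow> finite X"
  using finite_V finite_subset by auto

definition forest :: "'a set set \<Rightarrow> bool" where
  "forest T \<longleftrightarrow> T \<subseteq> E \<and> (\<forall>X\<subseteq>V. card (induced T X) \<le> card X - 1)"

lemma edge_neq: "{a, b} \<in> E \<Longrightarrow> a \<noteq> b"
  using edge[of "{a, b}"] by auto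

text \<open>The form in which cycles are excluded below: a cycle has as many edges as
  vertices.\<close>

lemma forest_not_dense:
  assumes "forest T" "finite S" "S \<subseteq> T" "\<Union>S \<subseteq> X" "X \<subseteq> V" "X \<noteq> {}"
  shows "card S < card X"
proof -
  have fin: "finite X" by (rule finite_vertices[OF assms(5)])
  have "card S \<le> card (induced T X)"
    using assms by (intro card_mono finite_induced) (auto simp: forest_def induced_def)
  also have "\<dots> \<le> card X - 1" using assms by (simp add: forest_def)
  finally show ?thesis using fin assms(6) by (metis One_nat_def Suc_pred card_gt_0_iff le_imp_less_Suc)
qed

text \<open>The critical sets contain \<open>a\<close> and \<open>b\<close> but not
  \<open>c\<close>: adding \<open>c\<close> brings in both \<open>ac\<close> and \<open>cb\<close>,
  so such a set spans at most \<open>card X - 2\<close> edges of \<open>T\<close> and has room for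
  \<open>ab\<close>.\<close>

lemma forest_swap:
  assumes T: "forest T" and ac: "{a, c} \<in> T" and cb: "{c, b} \<in> T" and ab: "{a, b} \<in> E" "{a, b} \<notin> T"
  shows "forest (insert {a, b} (T - {{a, c}}))"
  unfolding forest_def
proof (intro conjI allI impI)
  have TE: "T \<subseteq> E" using T by (simp add: forest_def)
  show "insert {a, b} (T - {{a, c}}) \<subseteq> E" using TE ab by auto
  fix X assume X: "X \<subseteq> V"
  have finX: "finite X" using X finite_V finite_subset by auto
  let ?T = "insert {a, b} (T - {{a, c}})"
  have ne: "a \<noteq> b" "a \<noteq> c" "c \<noteq> b" using edge_neq ab ac cb TE by auto
  have TX: "card (induced T X) \<le> card X - 1" using T X by (simp add: forest_def)
  have fin: "finite (induced T Y)" for Y by (rule finite_induced[OF TE])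
  consider "\<not> {a, b} \<subseteq> X" | "{a, b, c} \<subseteq> X" | "{a, b} \<subseteq> X" "c \<notin> X" by blast
  then show "card (induced ?T X) \<le> card X - 1"
  proof cases
    case 1
    then have "induced ?T X \<subseteq> induced T X" by (auto simp: induced_def)
    then show ?thesis using TX card_mono[OF fin] by (meson le_trans)
  next
    case 2
    then have eq: "induced ?T X = insert {a, b} (induced T X - {{a, c}})" by (auto simp: induced_def)
    have mem: "{a, c} \<in> induced T X" "{a, b} \<notin> induced T X" using 2 ac ab by (auto simp: induced_def)
    then have "card (induced T X) > 0" using fin card_gt_0_iff by blast
    then have "card (induced ?T X) = card (induced T X)"
      unfolding eq using mem fin by (simp add: card_Diff_singleton)
    then show ?thesis using TX by simp
  next
    case 3
    have "induced T X \<union> {{a, c}, {c, b}} \<subseteq> induced T (insert c X)"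
      using 3 ac cb by (auto simp: induced_def)
    then have "card (induced T X \<union> {{a, c}, {c, b}}) \<le> card (induced T (insert c X))"
      by (rule card_mono[OF fin])
    also have "\<dots> \<le> card (insert c X) - 1"
    proof -
      have "c \<in> V" using ac TE edge by auto
      then show ?thesis using T X by (simp add: forest_def)
    qed
    also have "\<dots> = card X" using 3 finX by simp
    also have "card (induced T X \<union> {{a, c}, {c, b}}) = card (induced T X) + 2"
    proof -
      have "{a, c} \<noteq> {c, b}" using ne by (auto simp: doubleton_eq_iff)
      then show ?thesis using 3 fin[of X] by (subst card_Un_disjoint) (auto simp: induced_def)
    qed
    finally have "card (induced T X) + 2 \<le> card X" .
    moreover have "card (induced ?T X) \<le> card (induced T X) + 1"
    proof -
      have "card (induced ?T X) \<le> card (insert {a, b} (induced T X))"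
        using fin by (intro card_mono) (auto simp: induced_def)
      also have "\<dots> \<le> card (induced T X) + 1" using fin by (simp add: card_insert_if)
      finally show ?thesis .
    qed
    ultimately show ?thesis by simp
  qed
qed

text \<open>If \<open>p\<close> were not adjacent to \<open>c\<close>, the paths from
  \<open>p\<close> to \<open>a\<close> and to \<open>b\<close> would form a cycle with the path
  \<open>a\<close>, \<open>c\<close>, \<open>b\<close>: a 4-cycle if their middle vertices agree, a
  6-cycle otherwise.\<close>

lemma forest_common_centre:
  assumes T: "forest T" and T': "{a, c} \<in> T" "{c, b} \<in> T" "{p, x} \<in> T" "{x, a} \<in> T" "{p, y} \<in> T" "{y, b} \<in> T"
    and ab: "{a, b} \<notin> T" and ne: "a \<noteq> b" "p \<noteq> a" "p \<noteq> b" "p \<noteq> c"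
  shows "{p, c} \<in> T"
proof (rule ccontr)
  assume pc: "{p, c} \<notin> T"
  have TE: "T \<subseteq> E" using T by (simp add: forest_def)
  have V: "a \<in> V" "b \<in> V" "c \<in> V" "p \<in> V" "x \<in> V" "y \<in> V" using T' TE edge by blast+
  have ne1: "a \<noteq> c" "c \<noteq> b" "p \<noteq> x" "x \<noteq> a" "p \<noteq> y" "y \<noteq> b" using T' TE edge_neq by blast+
  have ne2: "x \<noteq> c" "y \<noteq> c" "x \<noteq> b" "y \<noteq> a" using T' pc ab by (auto simp: insert_commute)
  show False
  proof (cases "x = y")
    case True
    have "card {{a, c}, {c, b}, {x, a}, {x, b}} < card {a, b, c, x}"
      using T' V True by (intro forest_not_dense[OF T]) auto
    moreover have "card {{a, c}, {c, b}, {x, a}, {x, b}} = 4"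
      using ne ne1 ne2 by (simp add: doubleton_eq_iff)
    moreover have "card {a, b, c, x} = 4" using ne ne1 ne2 by simp
    ultimately show False by simp
  next
    case False
    have "card {{a, c}, {c, b}, {p, x}, {x, a}, {p, y}, {y, b}} < card {a, b, c, p, x, y}"
      using T' V by (intro forest_not_dense[OF T]) auto
    moreover have "card {{a, c}, {c, b}, {p, x}, {x, a}, {p, y}, {y, b}} = 6"
      using ne ne1 ne2 False by (simp add: doubleton_eq_iff)
    moreover have "card {a, b, c, p, x, y} = 6" using ne ne1 ne2 False by simp
    ultimately show False by simp
  qed
qed

text \<open>
  Suppose the leftover edge closes a triangle in both forests in every such configuration. Exchanging
  \<open>ab\<close> with the edges of the triangle \<open>abc\<close> in \<open>T\<close> shows that \<open>a, b, c\<close> are pairwise at distance two in \<open>S\<close>,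
  hence have a common neighbour \<open>p\<close> there; the same argument for the triangle \<open>abp\<close> puts the edge \<open>pc\<close>
  into \<open>T\<close> as well.
\<close>

lemma two_trees_and_edge:
  assumes forests: "forest S" "forest T" and e: "e \<in> E" and disj: "S \<inter> T = {}" "e \<notin> S" "e \<notin> T"
  shows "\<exists>S' T' e'. S' \<union> T' \<union> {e'} = S \<union> T \<union> {e} \<and> S' \<inter> T' = {} \<and> e' \<notin> S' \<and> e' \<notin> T' \<and>
    forest S' \<and> forest T' \<and> \<not> closes_triangle T' e'"
proof (rule ccontr)
  assume "\<not> ?thesis"
  then have cl2: "closes_triangle T' e'" if "S' \<union> T' \<union> {e'} = S \<union> T \<union> {e}" "S' \<inter> T' = {}" "e' \<notin> S'" "e' \<notin> T'"
    "forest S'" "forest T'" for S' T' e' using that by blast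
  \<comment> \<open>The claim is asymmetric in the two forests; exchanging their roles shows that
    \<open>e'\<close> closes a triangle in the first one as well.\<close>
  have cl1: "closes_triangle S' e'" if st: "S' \<union> T' \<union> {e'} = S \<union> T \<union> {e}" "S' \<inter> T' = {}" "e' \<notin> S'" "e' \<notin> T'"
    "forest S'" "forest T'" for S' T' e'
    by (rule cl2[of T' S' e']) (use st in \<open>simp_all add: Un_commute Int_commute\<close>)
  have cl: "closes_triangle S' e'" "closes_triangle T' e'"
    if "S' \<union> T' \<union> {e'} = S \<union> T \<union> {e}" "S' \<inter> T' = {}" "e' \<notin> S'" "e' \<notin> T'" "forest S'" "forest T'" for S' T' e'
    using cl1[OF that] cl2[OF that] .
  have SE: "S \<subseteq> E" "T \<subseteq> E" using forests by (auto simp: forest_def)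
  have path: "\<exists>z. {u, z} \<in> R \<and> {z, v} \<in> R" if "closes_triangle R {u, v}" for R u v
  proof -
    obtain a b c where "{u, v} = {a, b}" "{a, c} \<in> R" "{c, b} \<in> R"
      using \<open>closes_triangle R {u, v}\<close> by (auto simp: closes_triangle_def)
    then have "(u = a \<and> v = b) \<or> (u = b \<and> v = a)" by (simp add: doubleton_eq_iff)
    then show ?thesis using \<open>{a, c} \<in> R\<close> \<open>{c, b} \<in> R\<close> by (auto simp: insert_commute)
  qed
  obtain a b c where abc: "e = {a, b}" "{a, c} \<in> T" "{c, b} \<in> T"
    using cl(2)[of S T e] disj forests by (auto simp: closes_triangle_def)
  have "closes_triangle S {a, b}" using cl(1)[of S T e] disj forests abc(1) by simp
  from path[OF this] obtain p where p: "{a, p} \<in> S" "{p, b} \<in> S" by blast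
  have ab: "a \<noteq> b" "{a, b} \<in> E" using e abc(1) edge_neq by auto
  have ne: "a \<noteq> c" "c \<noteq> b" "a \<noteq> p" "p \<noteq> b"
    using abc(2,3) p SE edge_neq[of a c] edge_neq[of c b] edge_neq[of a p] edge_neq[of p b] by auto
  have pc: "p \<noteq> c" using abc(2) p(1) disj(1) by auto
  have ab': "{a, b} \<notin> S" "{a, b} \<notin> T" using disj abc(1) by auto
  have swap: "forest (insert {a, b} (R - {{a, z}}))" "forest (insert {a, b} (R - {{z, b}}))"
    if R: "forest R" "{a, z} \<in> R" "{z, b} \<in> R" "{a, b} \<notin> R" for R z
  proof -
    show "forest (insert {a, b} (R - {{a, z}}))" by (rule forest_swap[OF R(1-3) ab(2) R(4)])
    have "{b, z} \<in> R" "{z, a} \<in> R" "{b, a} \<in> E" "{b, a} \<notin> R"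
      using R(2-4) ab(2) by (simp_all add: insert_commute)
    from forest_swap[OF R(1) this] show "forest (insert {a, b} (R - {{z, b}}))"
      by (simp add: insert_commute)
  qed
  note sw = swap[OF forests(2) abc(2,3) ab'(2)] swap[OF forests(1) p ab'(1)]
  \<comment> \<open>Putting \<open>ab\<close> into \<open>T\<close> in place of \<open>ac\<close>
    leaves \<open>S\<close> alone and makes \<open>ac\<close> the leftover edge.\<close>
  have "closes_triangle S {a, c}"
    by (rule cl(1)[of S "insert {a, b} (T - {{a, c}})"])
      (use forests sw disj abc ne ab in \<open>auto simp: doubleton_eq_iff\<close>)
  from path[OF this] obtain q where q: "{a, q} \<in> S" "{q, c} \<in> S" by blast
  have "closes_triangle S {c, b}"
    by (rule cl(1)[of S "insert {a, b} (T - {{c, b}})"])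
      (use forests sw disj abc ne ab in \<open>auto simp: doubleton_eq_iff\<close>)
  from path[OF this] obtain r where r: "{c, r} \<in> S" "{r, b} \<in> S" by blast
  \<comment> \<open>Here the given path is \<open>a\<close>, \<open>p\<close>, \<open>b\<close>, and
    \<open>c\<close> is the vertex at distance two from both of its ends.\<close>
  have S: "{c, p} \<in> S"
    using p q r disj abc(1) ab ne pc
    by (intro forest_common_centre[OF forests(1), of a p b c q r]) (auto simp: insert_commute)
  have "closes_triangle T {a, p}"
    by (rule cl(2)[of "insert {a, b} (S - {{a, p}})" T])
      (use forests sw disj abc p ne ab in \<open>auto simp: doubleton_eq_iff\<close>)
  from path[OF this] obtain x where x: "{a, x} \<in> T" "{x, p} \<in> T" by blast
  have "closes_triangle T {p, b}"
    by (rule cl(2)[of "insert {a, b} (S - {{p, b}})" T])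
      (use forests sw disj abc p ne ab in \<open>auto simp: doubleton_eq_iff\<close>)
  from path[OF this] obtain y where y: "{p, y} \<in> T" "{y, b} \<in> T" by blast
  have "{p, c} \<in> T"
    using abc x y disj ab ne pc
    by (intro forest_common_centre[OF forests(2), of a c b p x y]) (auto simp: insert_commute)
  then show False using S disj(1) by (auto simp: insert_commute)
qed

text \<open>\<open>T\<close> spans \<open>M\<close> by a tree, so for \<open>X\<close> meeting
  \<open>M\<close> at most \<open>card (X \<union> M) - card M\<close> edges of \<open>T\<close>
  inside \<open>X\<close> are not inside \<open>M\<close>. With at most
  \<open>card (X \<inter> M) - 1\<close> edges of \<open>T'\<close> this adds up to
  \<open>card X - 1\<close>.\<close>

lemma forest_replace:
  assumes T: "forest T" and M: "M \<subseteq> V" "M \<noteq> {}" "card (induced T M) = card M - 1"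
    and T': "forest T'" "\<And>e. e \<in> T' \<Longrightarrow> e \<subseteq> M"
  shows "forest ((T - induced T M) \<union> T')"
  unfolding forest_def
proof (intro conjI allI impI)
  have TE: "T \<subseteq> E" "T' \<subseteq> E" using T T' by (auto simp: forest_def)
  then show "(T - induced T M) \<union> T' \<subseteq> E" by auto
  fix X assume X: "X \<subseteq> V"
  have fin: "finite X" "finite M" using X M finite_V finite_subset by auto
  have finT: "finite (induced T Y)" "finite (induced T' Y)" for Y using finite_induced TE by auto
  let ?N = "(T - induced T M) \<union> T'"
  show "card (induced ?N X) \<le> card X - 1"
  proof (cases "X \<inter> M = {}")
    case True
    have "induced ?N X \<subseteq> induced T X"
    proof
      fix e assume e: "e \<in> induced ?N X"
      show "e \<in> induced T X"
      proof (rule ccontr)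
        assume "e \<notin> induced T X"
        then have "e \<in> T'" "e \<subseteq> X" using e by (auto simp: induced_def)
        then have "e = {}" using T'(2) True by blast
        then show False using edge[of e] \<open>e \<in> T'\<close> TE by auto
      qed
    qed
    then have "card (induced ?N X) \<le> card (induced T X)" by (rule card_mono[OF finT(1)])
    then show ?thesis using T X by (auto simp: forest_def)
  next
    case False
    have pos: "card (X \<inter> M) > 0" "card M > 0" using False fin M(2) by (auto simp: card_gt_0_iff)
    have "card (induced T X - induced T M) + card (induced T M) = card ((induced T X - induced T M) \<union> induced T M)"
      using finT by (intro card_Un_disjoint[symmetric]) auto
    also have "\<dots> \<le> card (induced T (X \<union> M))"
      using finT by (intro card_mono) (auto simp: induced_def)
    also have "\<dots> \<le> card (X \<union> M) - 1" using T X M by (simp add: forest_def)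
    finally have 1: "card (induced T X - induced T M) + (card M - 1) \<le> card (X \<union> M) - 1" using M(3) by simp
    have 2: "card (induced T' (X \<inter> M)) \<le> card (X \<inter> M) - 1" using T'(1) X by (simp add: forest_def le_infI1)
    have "induced ?N X \<subseteq> (induced T X - induced T M) \<union> induced T' (X \<inter> M)"
      using T'(2) by (auto simp: induced_def)
    then have "card (induced ?N X) \<le> card ((induced T X - induced T M) \<union> induced T' (X \<inter> M))"
      using finT by (intro card_mono) auto
    also have "\<dots> \<le> card (induced T X - induced T M) + card (induced T' (X \<inter> M))" by (rule card_Un_le)
    moreover have "card M \<le> card (X \<union> M)" using fin by (intro card_mono) auto
    ultimately show ?thesis using 1 2 pos card_Un_Int[OF fin] by linarith
  qed
qed

end

section \<open>Graphs with at most 2n - 1 edges on any n vertices\<close>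

locale sparse2_graph = edge_set +
  assumes sparse2: "X \<subseteq> V \<Longrightarrow> X \<noteq> {} \<Longrightarrow> card (induced E X) + 1 \<le> 2 * card X"
begin

definition full :: "'a set \<Rightarrow> bool" where
  "full X \<longleftrightarrow> X \<subseteq> V \<and> X \<noteq> {} \<and> card (induced E X) + 1 = 2 * card X"

definition cores :: "'a set set" where
  "cores = {M. full M \<and> (\<forall>Y. full Y \<longrightarrow> Y \<subseteq> M \<longrightarrow> Y = M)}"

text \<open>Supermodular edge counts against the modular bound \<open>2 * card X - 1\<close>, which
  is available for nonempty sets only. Hence minimal full sets are pairwise disjoint.\<close>

lemma full_Int:
  assumes X: "full X" and Y: "full Y" and ne: "X \<inter> Y \<noteq> {}"
  shows "full (X \<inter> Y)"
proof -
  have V: "X \<subseteq> V" "Y \<subseteq> V" using X Y by (auto simp: full_def)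
  have fin: "finite X" "finite Y" using V finite_vertices by auto
  have "card (induced E X) + card (induced E Y) \<le> card (induced E (X \<union> Y)) + card (induced E (X \<inter> Y))"
    by (rule card_induced_supermodular[OF finite_E])
  moreover have "card (induced E (X \<union> Y)) + 1 \<le> 2 * card (X \<union> Y)"
    using V ne by (intro sparse2) auto
  moreover have "card (induced E (X \<inter> Y)) + 1 \<le> 2 * card (X \<inter> Y)"
    using V ne by (intro sparse2) auto
  moreover have "card X + card Y = card (X \<union> Y) + card (X \<inter> Y)" by (rule card_Un_Int[OF fin])
  moreover have "card (induced E X) + 1 = 2 * card X" "card (induced E Y) + 1 = 2 * card Y"
    using X Y by (auto simp: full_def)
  ultimately have "card (induced E (X \<inter> Y)) + 1 = 2 * card (X \<inter> Y)" by linarith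
  then show ?thesis using V ne by (auto simp: full_def)
qed

lemma cores_disjoint:
  assumes "M \<in> cores" "N \<in> cores" "M \<inter> N \<noteq> {}"
  shows "M = N"
proof -
  have "full (M \<inter> N)" using assms by (intro full_Int) (auto simp: cores_def)
  then have "M \<inter> N = M" "M \<inter> N = N" using assms unfolding cores_def by auto
  then show ?thesis by simp
qed

lemma full_contains_core:
  assumes "full X" obtains M where "M \<in> cores" "M \<subseteq> X"
proof -
  let ?S = "{Y. full Y \<and> Y \<subseteq> X}"
  have "finite ?S" using assms finite_vertices by (auto simp: full_def)
  moreover have "X \<in> ?S" using assms by simp
  ultimately obtain M where M: "M \<in> ?S" "\<And>Y. Y \<in> ?S \<Longrightarrow> Y \<subseteq> M \<Longrightarrow> M = Y"
    using finite_has_minimal[of ?S] by (metis (no_types, lifting) empty_iff)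
  then have "M \<in> cores" by (auto simp: cores_def)
  then show ?thesis using that M(1) by auto
qed

text \<open>\<open>R\<close> collects one deleted edge per core. In the end \<open>F\<close> is the
  forest of the decomposition, and all of \<open>R\<close> is returned to \<open>H\<close>.\<close>

definition system :: "'a set set \<Rightarrow> 'a set set \<Rightarrow> 'a set set \<Rightarrow> bool" where
  "system F H R \<longleftrightarrow> F \<union> H \<union> R = E \<and> F \<inter> H = {} \<and> F \<inter> R = {} \<and> H \<inter> R = {} \<and> forest F \<and> forest H \<and>
     (\<forall>M\<in>cores. \<exists>e. induced R M = {e}) \<and> (\<forall>e\<in>R. \<exists>M\<in>cores. e \<subseteq> M)"

lemma system_core: "system F H R \<Longrightarrow> e \<in> R \<Longrightarrow> \<exists>M\<in>cores. e \<subseteq> M"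
  by (simp add: system_def)

lemma edge_in_one_core:
  assumes "M \<in> cores" "N \<in> cores" "e \<in> E" "e \<subseteq> M" "e \<subseteq> N"
  shows "M = N"
proof -
  have "e \<noteq> {}" using edge[OF assms(3)] by auto
  then show ?thesis using assms by (intro cores_disjoint) auto
qed

text \<open>Every full set contains a core and so loses an edge; thus \<open>E - R\<close> has at
  most \<open>2 * card X - 2\<close> edges on each nonempty \<open>X\<close>. The decomposition
  theorem with the bound \<open>n - 1\<close> in place of \<open>\<beta>\<close> then yields two
  forests.\<close>

lemma system_exists:
  shows "\<exists>F H R. system F H R"
proof (cases "E = {}")
  case True
  have "cores = {}"
  proof (rule equals0I)
    fix M assume "M \<in> cores"
    then have "M \<subseteq> V" "M \<noteq> {}" "card (induced E M) + 1 = 2 * card M" by (auto simp: cores_def full_def)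
    then show False using True by (simp add: induced_def)
  qed
  then have "system {} {} {}" unfolding system_def forest_def using True by (simp add: induced_def)
  then show ?thesis by blast
next
  case False
  have "\<exists>e. e \<in> induced E M" if "M \<in> cores" for M
  proof (rule ccontr)
    assume "\<nexists>e. e \<in> induced E M"
    then have "induced E M = {}" by auto
    then have "1 = 2 * card M" using that by (auto simp: cores_def full_def)
    then show False by presburger
  qed
  then obtain r where r: "\<And>M. M \<in> cores \<Longrightarrow> r M \<in> induced E M" by metis
  define R where "R = r ` cores"
  have RE: "R \<subseteq> E" using r by (auto simp: R_def induced_def)
  have R1: "induced R M = {r M}" if M: "M \<in> cores" for M
  proof
    show "{r M} \<subseteq> induced R M" using r[OF M] M by (auto simp: R_def induced_def)
    show "induced R M \<subseteq> {r M}"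
    proof
      fix e assume "e \<in> induced R M"
      then obtain N where N: "N \<in> cores" "e = r N" "e \<subseteq> M" by (auto simp: R_def induced_def)
      then have "N = M" using r[OF N(1)] M by (intro edge_in_one_core[of N M e]) (auto simp: induced_def)
      then show "e \<in> {r M}" using N by simp
    qed
  qed
  have sub: "card (induced (E - R) X) + 2 \<le> 2 * card X" if X: "X \<subseteq> V" "X \<noteq> {}" for X
  proof (cases "full X")
    case True
    then obtain M where M: "M \<in> cores" "M \<subseteq> X" by (rule full_contains_core)
    have "r M \<in> induced E X" "r M \<notin> induced (E - R) X"
      using r[OF M(1)] M by (auto simp: induced_def R_def)
    moreover have "induced (E - R) X \<subseteq> induced E X" by (auto simp: induced_def)
    ultimately have "card (induced (E - R) X) < card (induced E X)"
      by (intro psubset_card_mono finite_induced) auto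
    then show ?thesis using True by (simp add: full_def)
  next
    case False
    have "card (induced (E - R) X) \<le> card (induced E X)"
      by (intro card_mono finite_induced) (auto simp: induced_def)
    then show ?thesis using sparse2[OF X] False X by (auto simp: full_def)
  qed
  define N where "N = real (card V)"
  have N: "2 \<le> N"
  proof -
    obtain e where "e \<in> E" using False by auto
    then have "2 \<le> card V" using edge[of e] card_mono[OF finite_V, of e] by auto
    then show ?thesis by (simp add: N_def)
  qed
  have "\<exists>F H. F \<union> H = E - R \<and> F \<inter> H = {} \<and>
      (\<forall>X\<subseteq>V. card (induced F X) \<le> card X - 1) \<and> (\<forall>X\<subseteq>V. card (induced H X) \<le> card X - 1)"
  \<comment> \<open>Since \<open>card X \<le> N\<close>, the bound \<open>2 * card X - 2\<close> is
    at most \<open>2 - 2 / N\<close> times \<open>card X\<close>. This density is at least 1 as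
    \<open>N \<ge> 2\<close>, and being below 2 it makes the rank hypothesis strict.\<close>
  proof (rule forest_count_decomposition[of V "E - R" "\<lambda>n. n - 1" 2 "2 - 2 / N"])
    show "edge_set V (E - R)" using finite_V edge by unfold_locales auto
    show "count_function (\<lambda>n. n - 1) 2" by (rule count_function_forest)
    show "1 \<le> 2 - 2 / N" using N by (simp add: field_simps)
    show "real (card (induced (E - R) X)) \<le> (2 - 2 / N) * real (card X)" if X: "X \<subseteq> V" for X
    proof (cases "X = {}")
      case True
      have "induced (E - R) {} = {}" using edge by (fastforce simp: induced_def)
      then show ?thesis using True by simp
    next
      case False
      have "card X \<le> card V" by (rule card_mono[OF finite_V X])
      then have "2 * real (card X) / N \<le> 2" using N by (simp add: N_def field_simps)
      moreover have "real (card (induced (E - R) X) + 2) \<le> real (2 * card X)"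
        using sub[OF X False] by (simp only: of_nat_le_iff)
      ultimately show ?thesis by (simp add: algebra_simps)
    qed
    show "(2 - 2 / N - 1) * (real (card (induced (E - R) X)) - real (card X - 1)) < real (card X - 1)"
      if X: "X \<subseteq> V" "2 \<le> card X" for X
    proof -
      have "X \<noteq> {}" using X by auto
      then have "real (card (induced (E - R) X)) - real (card X - 1) \<le> real (card X - 1)"
        using sub[OF X(1)] by linarith
      then have "(2 - 2 / N - 1) * (real (card (induced (E - R) X)) - real (card X - 1))
          \<le> (2 - 2 / N - 1) * real (card X - 1)"
        using N by (intro mult_left_mono) (auto simp: field_simps)
      also have "\<dots> < 1 * real (card X - 1)"
        using N X by (intro mult_strict_right_mono) auto
      finally show ?thesis by simp
    qed
  qed
  then obtain F H where FH: "F \<union> H = E - R" "F \<inter> H = {}"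
    "\<forall>X\<subseteq>V. card (induced F X) \<le> card X - 1" "\<forall>X\<subseteq>V. card (induced H X) \<le> card X - 1"
    by (elim exE conjE)
  have "F \<union> H \<union> R = E" "F \<inter> R = {}" "H \<inter> R = {}" using FH(1) RE by auto
  moreover have "F \<subseteq> E" "H \<subseteq> E" using FH(1) by auto
  then have "forest F" "forest H" using FH(3,4) unfolding forest_def by blast+
  moreover have "\<forall>e\<in>R. \<exists>M\<in>cores. e \<subseteq> M" using r by (auto simp: R_def induced_def)
  moreover have "\<forall>M\<in>cores. \<exists>e. induced R M = {e}" using R1 by blast
  ultimately have "system F H R" using FH(2) unfolding system_def by (intro conjI)
  then show ?thesis by blast
qed

text \<open>A core spans \<open>2 * card M - 1\<close> edges, one of them in \<open>R\<close>; the
  two forests share the other \<open>2 * card M - 2\<close>, so both induce spanning trees of the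
  core.\<close>

lemma system_core_tight:
  assumes s: "system F H R" and M: "M \<in> cores"
  shows "card (induced F M) = card M - 1" "card (induced H M) = card M - 1"
proof -
  have M': "M \<subseteq> V" "M \<noteq> {}" "card (induced E M) + 1 = 2 * card M" using M by (auto simp: cores_def full_def)
  obtain e where e: "induced R M = {e}" using s M by (auto simp: system_def)
  have sub: "F \<subseteq> E" "H \<subseteq> E" "R \<subseteq> E" using s by (auto simp: system_def)
  have "induced E M = induced F M \<union> induced H M \<union> induced R M" using s by (auto simp: system_def induced_def)
  then have "card (induced E M) \<le> card (induced F M) + card (induced H M) + card (induced R M)"
    by (metis card_Un_le add_le_mono1 le_trans)
  moreover have "card (induced F M) \<le> card M - 1" "card (induced H M) \<le> card M - 1"
    using s M' by (auto simp: system_def forest_def)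
  moreover have "card M > 0" using M' finite_vertices by (auto simp: card_gt_0_iff)
  ultimately show "card (induced F M) = card M - 1" "card (induced H M) = card M - 1"
    using M'(3) e by auto
qed

text \<open>\<open>H\<close> spans \<open>M\<close> by a tree, so two edges of \<open>H\<close> from
  an outside vertex into \<open>M\<close> would close a cycle.\<close>

lemma triangle_in_core:
  assumes s: "system F H R" and M: "M \<in> cores" and e: "{a, b} \<in> E" "{a, b} \<subseteq> M" and c: "{a, c} \<in> H" "{c, b} \<in> H"
  shows "c \<in> M"
proof (rule ccontr)
  assume nc: "c \<notin> M"
  have M': "M \<subseteq> V" "M \<noteq> {}" using M by (auto simp: cores_def full_def)
  have HE: "H \<subseteq> E" and Hf: "forest H" using s by (auto simp: system_def)
  have "c \<in> V" using c HE edge by auto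
  have fin: "finite M" by (rule finite_vertices[OF M'(1)])
  have "a \<noteq> b" using edge_neq e by auto
  then have "{a, c} \<noteq> {c, b}" by (auto simp: doubleton_eq_iff)
  have "card (induced H M) + 2 = card (induced H M \<union> {{a, c}, {c, b}})"
    using nc \<open>{a, c} \<noteq> {c, b}\<close> finite_induced[OF HE] by (subst card_Un_disjoint) (auto simp: induced_def)
  also have "\<dots> \<le> card (induced H (insert c M))"
    using c e finite_induced[OF HE] by (intro card_mono) (auto simp: induced_def)
  also have "\<dots> \<le> card (insert c M) - 1" using Hf M' \<open>c \<in> V\<close> by (simp add: forest_def)
  also have "\<dots> = card M" using nc fin by simp
  finally show False using system_core_tight(2)[OF s M] by linarith
qed

text \<open>Take a system with the fewest edges of \<open>R\<close> closing a triangle in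
  \<open>H\<close>. A bad edge is repaired inside its core by \<open>two_trees_and_edge\<close>; as
  cores are disjoint, no other edge becomes bad.\<close>

lemma system_without_triangles:
  "\<exists>F H R. system F H R \<and> (\<forall>e\<in>R. \<not> closes_triangle H e)"
proof -
  let ?bad = "\<lambda>(F, H, R). card {e \<in> R. closes_triangle H e}"
  obtain F0 H0 R0 where "system F0 H0 R0" using system_exists by blast
  then have "(\<lambda>(F, H, R). system F H R) (F0, H0, R0)" by simp
  then obtain t where t: "(\<lambda>(F, H, R). system F H R) t"
    "\<And>t'. (\<lambda>(F, H, R). system F H R) t' \<Longrightarrow> ?bad t \<le> ?bad t'"
    using ex_has_least_nat[of "\<lambda>(F, H, R). system F H R" "(F0, H0, R0)" ?bad] by blast
  obtain F H R where FHR: "t = (F, H, R)" by (cases t)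
  have s: "system F H R" using t FHR by simp
  have least: "card {e \<in> R. closes_triangle H e} \<le> card {e \<in> R'. closes_triangle H' e}"
    if "system F' H' R'" for F' H' R'
    using t(2)[of "(F', H', R')"] that FHR by simp
  have sub: "F \<subseteq> E" "H \<subseteq> E" "R \<subseteq> E" and fo: "forest F" "forest H"
    and dis: "F \<inter> H = {}" "F \<inter> R = {}" "H \<inter> R = {}" and un: "F \<union> H \<union> R = E"
    using s by (auto simp: system_def)
  have "\<not> closes_triangle H e" if e: "e \<in> R" for e
  proof
    assume bad: "closes_triangle H e"
    obtain M where M: "M \<in> cores" "e \<subseteq> M" using system_core[OF s e] by blast
    have M': "M \<subseteq> V" "M \<noteq> {}" using M by (auto simp: cores_def full_def)
    have RM: "induced R M = {e}"
    proof -
      obtain e' where "induced R M = {e'}" using s M by (auto simp: system_def)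
      moreover have "e \<in> induced R M" using e M by (simp add: induced_def)
      ultimately show ?thesis by simp
    qed
    have sub_forest: "forest (induced T M)" if T: "forest T" for T
      unfolding forest_def
    proof (intro conjI allI impI)
      have TE: "T \<subseteq> E" using T by (simp add: forest_def)
      then show "induced T M \<subseteq> E" by (auto simp: induced_def)
      fix X assume X: "X \<subseteq> V"
      have "card (induced (induced T M) X) \<le> card (induced T X)"
        by (intro card_mono finite_induced[OF TE]) (auto simp: induced_def)
      also have "\<dots> \<le> card X - 1" using T X by (simp add: forest_def)
      finally show "card (induced (induced T M) X) \<le> card X - 1" .
    qed
    have "e \<in> E" using e sub by auto
    have "induced F M \<inter> induced H M = {}" "e \<notin> induced F M" "e \<notin> induced H M"
      using dis e by (auto simp: induced_def)
    from two_trees_and_edge[OF sub_forest[OF fo(1)] sub_forest[OF fo(2)] \<open>e \<in> E\<close> this]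
    obtain S T x where st: "S \<union> T \<union> {x} = induced F M \<union> induced H M \<union> {e}" "S \<inter> T = {}" "x \<notin> S" "x \<notin> T"
      "forest S" "forest T" "\<not> closes_triangle T x" by (elim exE conjE)
    have un': "S \<union> T \<union> {x} = induced E M"
      unfolding st(1) RM[symmetric] un[symmetric] by (auto simp: induced_def)
    have inE: "f \<in> E" "f \<subseteq> M" if "f \<in> S \<union> T \<union> {x}" for f
      using that unfolding un' by (simp_all add: induced_def)
    have inM: "\<And>f. f \<in> S \<Longrightarrow> f \<subseteq> M" "\<And>f. f \<in> T \<Longrightarrow> f \<subseteq> M" "x \<subseteq> M" "x \<in> E" "S \<subseteq> E" "T \<subseteq> E"
      using inE by auto
    define F' where "F' = (F - induced F M) \<union> S"
    define H' where "H' = (H - induced H M) \<union> T"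
    define R' where "R' = (R - {e}) \<union> {x}"
    have Re: "f \<in> R \<Longrightarrow> f \<subseteq> M \<Longrightarrow> f = e" for f using RM by (auto simp: induced_def)
    have F': "f \<in> F' \<longleftrightarrow> (if f \<subseteq> M then f \<in> S else f \<in> F)" for f
      unfolding F'_def induced_def using inM(1)[of f] by auto
    have H': "f \<in> H' \<longleftrightarrow> (if f \<subseteq> M then f \<in> T else f \<in> H)" for f
      unfolding H'_def induced_def using inM(2)[of f] by auto
    have R': "f \<in> R' \<longleftrightarrow> (if f \<subseteq> M then f = x else f \<in> R)" for f
      unfolding R'_def using Re[of f] inM(3) M(2) by auto
    have sys: "system F' H' R'" unfolding system_def
    proof (intro conjI ballI)
      show "forest F'" unfolding F'_def
        using system_core_tight[OF s M(1)] fo st M' inM by (intro forest_replace) auto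
      show "forest H'" unfolding H'_def
        using system_core_tight[OF s M(1)] fo st M' inM by (intro forest_replace) auto
      show "F' \<union> H' \<union> R' = E"
      proof
        show "F' \<union> H' \<union> R' \<subseteq> E" unfolding F'_def H'_def R'_def using sub inM(4-6) by blast
        show "E \<subseteq> F' \<union> H' \<union> R'"
        proof
          fix f assume f: "f \<in> E"
          show "f \<in> F' \<union> H' \<union> R'"
          proof (cases "f \<subseteq> M")
            case True
            then have "f \<in> S \<union> T \<union> {x}" using un' f by (simp add: induced_def)
            then show ?thesis by (auto simp: F'_def H'_def R'_def)
          next
            case False
            then have "f \<noteq> e" using M by auto
            then show ?thesis using f un False by (auto simp: F'_def H'_def R'_def induced_def)
          qed
        qed
      qed
      have "f \<notin> F' \<inter> H'" "f \<notin> F' \<inter> R'" "f \<notin> H' \<inter> R'" for f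
        using dis st(2-4) unfolding Int_iff F' H' R' by (cases "f \<subseteq> M"; auto)+
      then show "F' \<inter> H' = {}" "F' \<inter> R' = {}" "H' \<inter> R' = {}" by blast+
      show "\<exists>M\<in>cores. f \<subseteq> M" if "f \<in> R'" for f
      proof (cases "f = x")
        case True
        then show ?thesis using M(1) inM(3) by blast
      next
        case False
        then have "f \<in> R" using that by (simp add: R'_def)
        then show ?thesis using s by (simp add: system_def)
      qed
      show "\<exists>f. induced R' N = {f}" if N: "N \<in> cores" for N
      proof (cases "N = M")
        case True
        have "induced R' M = {x}" using inM(3) by (auto simp: R' induced_def)
        then show ?thesis using True by auto
      next
        case False
        then have "\<not> e \<subseteq> N" "\<not> x \<subseteq> N"
          using edge_in_one_core[OF M(1) N \<open>e \<in> E\<close> M(2)] edge_in_one_core[OF M(1) N inM(4,3)] by auto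
        then have "induced R' N = induced R N" by (auto simp: R'_def induced_def)
        then show ?thesis using s N by (auto simp: system_def)
      qed
    qed
    have "{f \<in> R'. closes_triangle H' f} \<subseteq> {f \<in> R. closes_triangle H f} - {e}"
    proof
      fix f assume f: "f \<in> {f \<in> R'. closes_triangle H' f}"
      then obtain a b c where abc: "f = {a, b}" "{a, c} \<in> H'" "{c, b} \<in> H'"
        by (auto simp: closes_triangle_def)
      have "f \<noteq> x"
      proof
        assume "f = x"
        \<comment> \<open>A triangle on \<open>x\<close> would lie inside \<open>M\<close>, where
          \<open>H'\<close> agrees with \<open>T\<close>, and \<open>T\<close> was chosen without
          one.\<close>
        then have "c \<in> M" using triangle_in_core[OF sys M(1) _ _ abc(2,3)] inM abc(1) by simp
        then have "{a, c} \<in> T" "{c, b} \<in> T"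
          using abc inM(3) \<open>f = x\<close> by (auto simp: H')
        then show False using st(7) \<open>f = x\<close> abc(1) by (auto simp: closes_triangle_def)
      qed
      then have fR: "f \<in> R" "f \<noteq> e" using f by (auto simp: R'_def)
      obtain N where N: "N \<in> cores" "f \<subseteq> N" using system_core[OF s fR(1)] by blast
      have "N \<noteq> M" using Re[of f] fR N(2) by auto
      then have NM: "N \<inter> M = {}" using cores_disjoint M N by blast
      have ab: "a \<in> N" "b \<in> N" using N(2) abc(1) by auto
      \<comment> \<open>Both edges have an end in the core \<open>N\<close>, which is disjoint from
        \<open>M\<close>, so the exchange did not touch them.\<close>
      then have "\<not> {a, c} \<subseteq> M" "\<not> {c, b} \<subseteq> M" using NM by auto
      then have "{a, c} \<in> H" "{c, b} \<in> H" using abc by (auto simp only: H' if_False)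
      then show "f \<in> {f \<in> R. closes_triangle H f} - {e}" using fR abc(1) by (auto simp: closes_triangle_def)
    qed
    moreover have "finite {f \<in> R. closes_triangle H f}" using finite_sub[OF sub(3)] by simp
    ultimately have "card {f \<in> R'. closes_triangle H' f} \<le> card ({f \<in> R. closes_triangle H f} - {e})"
      by (intro card_mono) auto
    also have "\<dots> < card {f \<in> R. closes_triangle H f}"
      using e bad finite_sub[OF sub(3)] by (intro psubset_card_mono) auto
    finally show False using least[OF sys] by simp
  qed
  then show ?thesis using s by blast
qed

text \<open>The second part is \<open>H \<union> R\<close>. Cores are disjoint, so \<open>R\<close>
  is a matching and \<open>X\<close> spans at most \<open>card X - 1\<close> edges of
  \<open>H\<close> and \<open>card X / 2\<close> of \<open>R\<close>; from five vertices on this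
  suffices for \<open>m \<ge> 9 / 5\<close>. Three vertices need the absence of triangles, four the
  trees on the cores.\<close>

theorem dense_decomposition:
  fixes m :: real
  assumes m: "9 / 5 \<le> m"
  shows "\<exists>F I. F \<union> I = E \<and> F \<inter> I = {} \<and> (\<forall>X\<subseteq>V. card (induced F X) \<le> card X - 1) \<and>
    (\<forall>X\<subseteq>V. 2 \<le> card X \<longrightarrow> card (induced I X) \<le> m * (real (card X) - 2) + 1)"
proof -
  obtain F H R where s: "system F H R" and tri: "\<And>e. e \<in> R \<Longrightarrow> \<not> closes_triangle H e"
    using system_without_triangles by blast
  have sub: "F \<subseteq> E" "H \<subseteq> E" "R \<subseteq> E" and fo: "forest F" "forest H"
    and dis: "F \<inter> H = {}" "F \<inter> R = {}" "H \<inter> R = {}" and un: "F \<union> H \<union> R = E"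
    using s by (auto simp: system_def)
  have core: "\<exists>M\<in>cores. e \<subseteq> M" if "e \<in> R" for e using system_core[OF s that] .
  have R_disj: "e \<inter> f = {}" if ef: "e \<in> R" "f \<in> R" "e \<noteq> f" for e f
  proof (rule ccontr)
    assume ne: "e \<inter> f \<noteq> {}"
    obtain M N where MN: "M \<in> cores" "e \<subseteq> M" "N \<in> cores" "f \<subseteq> N"
      using core[OF ef(1)] core[OF ef(2)] by blast
    then have "M = N" using ne by (intro cores_disjoint) auto
    moreover obtain g where "induced R M = {g}" using s MN by (auto simp: system_def)
    ultimately have "e = g" "f = g" using MN ef by (auto simp: induced_def)
    then show False using ef by simp
  qed
  have "card (induced (H \<union> R) X) \<le> m * (real (card X) - 2) + 1" if X: "X \<subseteq> V" "2 \<le> card X" for X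
  proof -
    have finX: "finite X" by (rule finite_vertices[OF X(1)])
    have finR: "finite (induced R X)" by (rule finite_induced[OF sub(3)])
    have "induced (H \<union> R) X = induced H X \<union> induced R X" by (auto simp: induced_def)
    then have tot: "card (induced (H \<union> R) X) \<le> card (induced H X) + card (induced R X)"
      by (simp add: card_Un_le)
    have h: "card (induced H X) \<le> card X - 1" using fo X by (simp add: forest_def)
    have "2 * card (induced R X) = (\<Sum>e\<in>induced R X. card e)"
      using edge sub(3) by (simp add: induced_def subset_iff)
    also have "\<dots> = card (\<Union>(induced R X))"
    proof (rule card_Union_disjoint[symmetric])
      show "pairwise disjnt (induced R X)" using R_disj by (simp add: pairwise_def disjnt_def induced_def)
      show "finite e" if "e \<in> induced R X" for e
        using that finite_subset[OF _ finX] by (simp add: induced_def)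
    qed
    also have "\<dots> \<le> card X" using finX by (intro card_mono) (auto simp: induced_def)
    finally have r: "2 * card (induced R X) \<le> card X" .
    have lin: "9 / 5 * (real (card X) - 2) \<le> m * (real (card X) - 2)"
      using m X by (intro mult_right_mono) auto
    consider "card X = 2" | "card X = 3" | "card X = 4" | "5 \<le> card X" using X by linarith
    then show ?thesis
    proof cases
      case 1
      have "card (induced (H \<union> R) X) \<le> card X choose 2"
        using sub X by (intro card_induced_le_choose) auto
      then show ?thesis using 1 by simp
    next
      case 2
      have "card (induced (H \<union> R) X) \<le> 2"
      proof (cases "induced R X = {}")
        case True
        then show ?thesis using tot h 2 by simp
      next
        case False
        then obtain e where e: "e \<in> R" "e \<subseteq> X" by (auto simp: induced_def)
        have "card e = 2" using e sub edge by auto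
        then obtain a b where ab: "e = {a, b}" "a \<noteq> b" by (auto simp: card_2_iff)
        have "card (X - e) = 1" using e 2 \<open>card e = 2\<close> by (simp add: card_Diff_subset finite_subset[OF _ finX])
        then obtain c where c: "X - e = {c}" by (auto simp: card_1_singleton_iff)
        have Xabc: "X = {a, b, c}" using c e ab by auto
        have "induced H X \<subseteq> {{a, c}, {c, b}}"
        proof
          fix f assume f: "f \<in> induced H X"
          then have "card f = 2" "f \<subseteq> {a, b, c}" "f \<noteq> {a, b}"
            using sub edge e dis ab Xabc by (auto simp: induced_def)
          then show "f \<in> {{a, c}, {c, b}}" by (auto simp: card_2_iff doubleton_eq_iff)
        qed
        moreover have "induced H X \<noteq> {{a, c}, {c, b}}"
          using tri[OF e(1)] ab by (auto simp: closes_triangle_def induced_def)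
        ultimately have "induced H X \<subset> {{a, c}, {c, b}}" by auto
        then have "card (induced H X) < card {{a, c}, {c, b}}" by (intro psubset_card_mono) auto
        also have "\<dots> \<le> 2" by (simp add: card_insert_if)
        finally have "card (induced H X) \<le> 1" by simp
        then show ?thesis using tot r 2 by simp
      qed
      then show ?thesis using 2 m by simp
    next
      case 3
      \<comment> \<open>Two edges of \<open>R\<close> in \<open>X\<close> come from different cores.
        The core \<open>M\<close> of \<open>e\<close> meets \<open>X\<close> only in
        \<open>e\<close>, which is not in \<open>H\<close>, and since \<open>H\<close> has a tree on
        \<open>M\<close>, at most two edges of \<open>H\<close> fit into \<open>X\<close>.\<close>
      have "card (induced (H \<union> R) X) \<le> 4"
      proof (cases "card (induced R X) \<le> 1")
        case True
        then show ?thesis using tot h 3 by simp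
      next
        case False
        then have "induced R X \<noteq> {}" by auto
        then obtain e where e: "e \<in> induced R X" by auto
        have "induced R X \<noteq> {e}" using False by auto
        then obtain f where f: "f \<in> induced R X" "f \<noteq> e" using e by auto
        have eR: "e \<in> R" "e \<subseteq> X" "f \<in> R" "f \<subseteq> X" using e f by (auto simp: induced_def)
        obtain M where M: "M \<in> cores" "e \<subseteq> M" using core[OF eR(1)] by blast
        obtain N where N: "N \<in> cores" "f \<subseteq> N" using core[OF eR(3)] by blast
        have "M \<noteq> N"
        proof
          assume "M = N"
          moreover obtain g where "induced R M = {g}" using s M by (auto simp: system_def)
          ultimately have "e = g" "f = g" using M N eR by (auto simp: induced_def)
          then show False using f by simp
        qed
        then have "M \<inter> N = {}" using cores_disjoint M N by blast
        have M': "M \<subseteq> V" "M \<noteq> {}" using M by (auto simp: cores_def full_def)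
        have finM: "finite M" by (rule finite_vertices[OF M'(1)])
        have c2: "card e = 2" "card f = 2" using eR sub edge by auto
        have "e \<inter> f = {}" using R_disj eR f by auto
        then have "card (e \<union> f) = 4"
          using c2 finX eR by (subst card_Un_disjoint) (auto intro: finite_subset)
        then have Xef: "X = e \<union> f" using 3 eR finX by (metis Un_least card_subset_eq)
        have XM: "X \<inter> M = e" using Xef M N \<open>M \<inter> N = {}\<close> by auto
        have "induced H e = {}"
        proof (rule equals0I)
          fix g assume g: "g \<in> induced H e"
          then have "g \<subseteq> e" "card g = 2" using sub edge by (auto simp: induced_def)
          then have "g = e" using c2 by (metis card_subset_eq card.infinite zero_neq_numeral)
          then show False using g eR dis by (auto simp: induced_def)
        qed
        then have "card (induced H X) + card (induced H M) \<le> card (induced H (X \<union> M))"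
          using card_induced_supermodular[OF finite_sub[OF sub(2)], of X M] XM by simp
        also have "\<dots> \<le> card (X \<union> M) - 1" using fo X M' by (simp add: forest_def)
        finally have "card (induced H X) + (card M - 1) \<le> card (X \<union> M) - 1"
          using system_core_tight(2)[OF s M(1)] by simp
        moreover have "card X + card M = card (X \<union> M) + 2"
          using card_Un_Int[OF finX finM] XM c2 by simp
        moreover have "card M > 0" using M' finM by (auto simp: card_gt_0_iff)
        ultimately have "card (induced H X) \<le> 2" using 3 by linarith
        then show ?thesis using tot r 3 by linarith
      qed
      then show ?thesis using 3 m by simp
    next
      case 4
      have c: "2 * card (induced (H \<union> R) X) + 2 \<le> 3 * card X" using tot h r 4 by linarith
      have "real (card (induced (H \<union> R) X)) \<le> 9 / 5 * (real (card X) - 2) + 1"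
      proof (cases "card X = 5")
        case True
        \<comment> \<open>Integrality matters: the count gives 6.5, while 6.4 is allowed.\<close>
        then have "card (induced (H \<union> R) X) \<le> 6" using c by linarith
        then show ?thesis using True by simp
      next
        case False
        then have "6 \<le> card X" using 4 by linarith
        then have "6 \<le> real (card X)" by simp
        moreover have "2 * real (card (induced (H \<union> R) X)) + 2 \<le> 3 * real (card X)"
          using of_nat_mono[OF c, where 'a = real] by simp
        ultimately show ?thesis by argo
      qed
      also have "\<dots> \<le> m * (real (card X) - 2) + 1" by (rule add_right_mono[OF lin])
      finally show ?thesis .
    qed
  qed
  moreover have "F \<union> (H \<union> R) = E" "F \<inter> (H \<union> R) = {}" using un dis by auto
  moreover have "\<forall>X\<subseteq>V. card (induced F X) \<le> card X - 1" using fo by (simp add: forest_def)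
  ultimately show ?thesis by blast
qed

end

section \<open>All densities together, and the theorem on graphs\<close>

lemma forest_sparse_decomposition:
  fixes m :: real
  assumes graph: "edge_set V E" and m: "1 < m"
    and dens: "\<And>X. X \<subseteq> V \<Longrightarrow> card (induced E X) \<le> m * card X"
  shows "\<exists>F I. F \<union> I = E \<and> F \<inter> I = {} \<and> (\<forall>X\<subseteq>V. card (induced F X) \<le> card X - 1) \<and>
    (\<forall>X\<subseteq>V. 2 \<le> card X \<longrightarrow> card (induced I X) \<le> m * (real (card X) - 2) + 1)"
proof -
  interpret edge_set V E by (rule graph)
  show ?thesis
  proof (cases "m < 9 / 5 \<or> 2 \<le> m")
    case True
    then obtain \<beta> n0 where adm: "admissible m \<beta> n0" using admissible_exists[OF m] by blast
    then have \<beta>: "count_function \<beta> n0" "\<And>n. 2 \<le> n \<Longrightarrow> \<beta> n \<le> m * (real n - 2) + 1"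
      "\<And>n (e::real). n0 \<le> n \<Longrightarrow> e \<le> m * n \<Longrightarrow> e \<le> real (n choose 2) \<Longrightarrow> (m - 1) * (e - \<beta> n) < \<beta> n"
      unfolding admissible_def by simp_all
    have "(m - 1) * (real (card (induced E X)) - \<beta> (card X)) < \<beta> (card X)"
      if X: "X \<subseteq> V" "n0 \<le> card X" for X
      using dens[OF X(1)] card_induced_le_choose[OF order_refl X(1)] by (intro \<beta>(3)[OF X(2)]) auto
    then have "\<exists>F I. F \<union> I = E \<and> F \<inter> I = {} \<and>
        (\<forall>X\<subseteq>V. card (induced F X) \<le> card X - 1) \<and> (\<forall>X\<subseteq>V. card (induced I X) \<le> \<beta> (card X))"
      using m dens by (intro forest_count_decomposition[OF graph \<beta>(1), of m]) auto
    then obtain F I where FI: "F \<union> I = E" "F \<inter> I = {}" "\<forall>X\<subseteq>V. card (induced F X) \<le> card X - 1"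
      "\<forall>X\<subseteq>V. card (induced I X) \<le> \<beta> (card X)" by (elim exE conjE)
    have "real (card (induced I X)) \<le> m * (real (card X) - 2) + 1" if X: "X \<subseteq> V" "2 \<le> card X" for X
    proof -
      have "card (induced I X) \<le> \<beta> (card X)" using FI(4) X(1) by simp
      then show ?thesis using \<beta>(2)[OF X(2)] by linarith
    qed
    then show ?thesis using FI(1-3) by (intro exI[of _ F] exI[of _ I]) simp
  next
    case False
    \<comment> \<open>Since \<open>m < 2\<close>, a nonempty \<open>X\<close> spans fewer than
      \<open>2 * card X\<close> edges, and integrality improves this by one.\<close>
    interpret sparse2_graph V E
    proof
      fix X assume X: "X \<subseteq> V" "X \<noteq> {}"
      have "card X > 0" using X finite_vertices by (simp add: card_gt_0_iff)
      then have "m * real (card X) < 2 * real (card X)"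
        using False by (intro mult_strict_right_mono) auto
      then have "real (card (induced E X)) < real (2 * card X)" using dens[OF X(1)] by simp
      then show "card (induced E X) + 1 \<le> 2 * card X" by linarith
    qed
    show ?thesis using False by (intro dense_decomposition) simp
  qed
qed

theorem theorem2:
  fixes m :: real and G :: "'a ugraph"
  assumes "m > 1"
    and "simple_graph G"
    and "sparse m 0 G"
  shows "\<exists>F G'. subgraph F G \<and> subgraph G' G \<and>
           edges G = edges F \<union> edges G' \<and> edges F \<inter> edges G' = {} \<and>
           sparse 1 (-1) F \<and> sparse m (1 - 2 * m) G'"
proof -
  let ?V = "verts G" and ?E = "edges G"
  interpret edge_set ?V ?E
    using assms(2) by unfold_locales (auto simp: simple_graph_def)
  have "real (card (induced ?E X)) \<le> m * real (card X)" if X: "X \<subseteq> ?V" for X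
  \<comment> \<open>Sparsity constrains only subgraphs with an edge; without one the bound holds as
    \<open>m\<close> is positive.\<close>
  proof (cases "induced ?E X = {}")
    case False
    let ?H = "\<lparr>verts = X, edges = induced ?E X\<rparr>"
    have "subgraph ?H G"
      using X finite_vertices[OF X] edge by (auto simp: subgraph_def simple_graph_def induced_def)
    then have "real (card (edges ?H)) \<le> m * real (card (verts ?H)) + 0"
      using assms(3) False unfolding sparse_def by (metis ugraph.select_convs(2))
    then show ?thesis by simp
  qed (use assms(1) in simp)
  then have "\<exists>F I. F \<union> I = ?E \<and> F \<inter> I = {} \<and> (\<forall>X\<subseteq>?V. card (induced F X) \<le> card X - 1) \<and>
    (\<forall>X\<subseteq>?V. 2 \<le> card X \<longrightarrow> card (induced I X) \<le> m * (real (card X) - 2) + 1)"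
    using assms(1) by (intro forest_sparse_decomposition edge_set_axioms)
  then obtain F I where FI: "F \<union> I = ?E" "F \<inter> I = {}"
    and F: "\<forall>X\<subseteq>?V. card (induced F X) \<le> card X - 1"
    and I: "\<forall>X\<subseteq>?V. 2 \<le> card X \<longrightarrow> card (induced I X) \<le> m * (real (card X) - 2) + 1"
    by (elim exE conjE)
  have sub: "F \<subseteq> ?E" "I \<subseteq> ?E" using FI(1) by auto
  have sg: "subgraph \<lparr>verts = ?V, edges = J\<rparr> G" if J: "J \<subseteq> ?E" for J
  proof -
    have "\<forall>e\<in>J. e \<subseteq> ?V \<and> card e = 2" using J edge by blast
    then show ?thesis using finite_V J by (simp add: subgraph_def simple_graph_def)
  qed
  \<comment> \<open>Both parts keep all vertices of \<open>G\<close>. A subgraph with an edge has at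
    least two vertices, which makes \<open>card X - 1\<close> exact and the bound on
    \<open>I\<close> applicable, and its edges are among the induced ones.\<close>
  have key: "verts H \<subseteq> ?V \<and> 2 \<le> card (verts H) \<and> card (edges H) \<le> card (induced J (verts H))"
    if J: "J \<subseteq> ?E" and H: "subgraph H \<lparr>verts = ?V, edges = J\<rparr>" "edges H \<noteq> {}" for J and H :: "'a ugraph"
  proof -
    have HV: "verts H \<subseteq> ?V" and HJ: "edges H \<subseteq> J" and HE: "\<forall>e\<in>edges H. e \<subseteq> verts H \<and> card e = 2"
      using H(1) by (auto simp: subgraph_def simple_graph_def)
    obtain e where e: "e \<in> edges H" using H(2) by auto
    then have "2 \<le> card (verts H)"
      using HE card_mono[OF finite_vertices[OF HV], of e] by auto
    moreover have "card (edges H) \<le> card (induced J (verts H))"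
      using HJ HE by (intro card_mono finite_induced[OF J]) (auto simp: induced_def)
    ultimately show ?thesis using HV by simp
  qed
  have "sparse 1 (-1) \<lparr>verts = ?V, edges = F\<rparr>" unfolding sparse_def
  proof (intro allI impI, elim conjE)
    fix H :: "'a ugraph" assume H: "subgraph H \<lparr>verts = ?V, edges = F\<rparr>" "edges H \<noteq> {}"
    have "card (induced F (verts H)) \<le> card (verts H) - 1" using F key[OF sub(1) H] by simp
    then show "real (card (edges H)) \<le> 1 * real (card (verts H)) + - 1"
      using key[OF sub(1) H] by linarith
  qed
  moreover have "sparse m (1 - 2 * m) \<lparr>verts = ?V, edges = I\<rparr>" unfolding sparse_def
  proof (intro allI impI, elim conjE)
    fix H :: "'a ugraph" assume H: "subgraph H \<lparr>verts = ?V, edges = I\<rparr>" "edges H \<noteq> {}"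
    have "real (card (edges H)) \<le> real (card (induced I (verts H)))" using key[OF sub(2) H] by simp
    also have "\<dots> \<le> m * (real (card (verts H)) - 2) + 1" using I key[OF sub(2) H] by simp
    finally show "real (card (edges H)) \<le> m * real (card (verts H)) + (1 - 2 * m)"
      by (simp add: algebra_simps)
  qed
  ultimately show ?thesis
    using sg[OF sub(1)] sg[OF sub(2)] FI
    by (intro exI[of _ "\<lparr>verts = ?V, edges = F\<rparr>"] exI[of _ "\<lparr>verts = ?V, edges = I\<rparr>"]) simp
qed

end
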